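(* Let $(a_n)_{n\ge0}$ be the sequence, listed in increasing order, of the non-negative integers $m$ such that $840m+361$ is a perfect square. Define $t(n)=0$ if $n\equiv 0,1,3,5,10,12,14,15 \pmod{16}$ and $t(n)=1$ otherwise. Then $$\sum_{n=0}^\infty(-1)^{t(n)}q^{a_n}=\frac{(q,q^6,q^7;q^7)_\infty}{(q,q^4;q^5)_\infty}.$$
   Context: Here $q$ is a complex number with $|q|<1$ (equivalently, the identity may be read as an identity of formal power series in $q$). For a complex number $a$, $(a;q)_\infty:=\prod_{i=0}^\infty(1-aq^i)$, and $(a_1,a_2,\dots,a_m;q)_\infty:=\prod_{j=1}^m(a_j;q)_\infty$. *)

theory Defs
  imports "HOL-Analysis.Analysis" "HOL-Computational_Algebra.Nth_Powers"
begin

definition qpoch_inf :: "complex \<Rightarrow> complex \<Rightarrow> complex" where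
  "qpoch_inf a q = (\<Prod>i. 1 - a * q ^ i)"

definition qpochs_inf :: "complex list \<Rightarrow> complex \<Rightarrow> complex" where
  "qpochs_inf as q = (\<Prod>a\<leftarrow>as. qpoch_inf a q)"

definition exponents :: "nat set" where
  "exponents = {m. is_square (840 * m + 361)}"

(* On an infinite set of naturals, enumerate lists the elements in increasing order from index 0;
   infinite_exponents below shows that this is the case that applies. *)
definition a_seq :: "nat \<Rightarrow> nat" where
  "a_seq n = enumerate exponents n"

definition t :: "nat \<Rightarrow> nat" where
  "t n = (if n mod 16 \<in> {0, 1, 3, 5, 10, 12, 14, 15} then 0 else 1)"

lemma infinite_exponents: "infinite exponents"
proof -
  let ?f = "\<lambda>j::nat. 840 * j ^ 2 + 38 * j"
  have "strict_mono ?f"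
    by (auto simp: strict_mono_def power2_eq_square intro!: add_le_less_mono mult_le_mono)
  then have "infinite (range ?f)"
    by (simp add: strict_mono_imp_inj_on range_inj_infinite)
  moreover have "range ?f \<subseteq> exponents"
  proof
    fix m assume "m \<in> range ?f"
    then obtain j where "m = ?f j" by blast
    then have "840 * m + 361 = (840 * j + 19) ^ 2"
      by (simp add: power2_eq_square algebra_simps)
    then show "m \<in> exponents"
      by (auto simp: exponents_def is_nth_power_def)
  qed
  ultimately show ?thesis
    using finite_subset by blast
qed

lemma strict_mono_a_seq: "strict_mono a_seq"
  unfolding a_seq_def [abs_def] using infinite_exponents by (rule strict_mono_enumerate)

lemma range_a_seq: "range a_seq = exponents"
  unfolding a_seq_def [abs_def] using infinite_exponents by (rule range_enumerate)

end

theory Submission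
  imports Defs
begin

text \<open>
  After multiplication by \<open>(q;q)\<^sub>\<infinity> = (q,q\<^sup>4;q\<^sup>5)\<^sub>\<infinity> (q\<^sup>2,q\<^sup>3,q\<^sup>5;q\<^sup>5)\<^sub>\<infinity>\<close> the claim compares
  \<open>(q,q\<^sup>6,q\<^sup>7;q\<^sup>7)\<^sub>\<infinity> (q\<^sup>2,q\<^sup>3,q\<^sup>5;q\<^sup>5)\<^sub>\<infinity>\<close> with \<open>(q;q)\<^sub>\<infinity>\<close> times the series. By the Jacobi triple product
  both are signed double sums, with exponents \<open>(15u\<^sup>2 + 21v\<^sup>2 - 396)/840\<close> and
  \<open>(x\<^sup>2 + 35y\<^sup>2 - 396)/840\<close> respectively. The substitution \<open>x = (5u - 7v)/2\<close>, \<open>y = (u + v)/2\<close>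
  (multiplication by \<open>(5 + \<surd>-35)/2\<close> in \<open>\<rat>(\<surd>-35)\<close>) turns one form into the other and matches the
  terms with \<open>u, v\<close> odd and \<open>3\<close> not dividing \<open>u + v\<close>. What is left over on either side is a sum of a
  function of \<open>(a, b)\<close> that is odd in \<open>b\<close>, over the pairs with \<open>3\<close> dividing \<open>a - b\<close> respectively not dividing \<open>a + b\<close>,
  and these two sums agree by the symmetry \<open>b \<mapsto> -b\<close>.
\<close>

section \<open>The Jacobi triple product\<close>

lemma convergent_prod_qpoch:
  fixes a q :: complex
  assumes "norm q < 1"
  shows "convergent_prod (\<lambda>i. 1 - a * q ^ i)"
proof -
  have "summable (\<lambda>i. norm a * norm q ^ i)"
    using assms by (intro summable_mult summable_geometric) auto
  then have "abs_convergent_prod (\<lambda>i. 1 - a * q ^ i)"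
    unfolding abs_convergent_prod_conv_summable by (simp add: norm_mult norm_power)
  then show ?thesis
    by (rule abs_convergent_prod_imp_convergent_prod)
qed

lemma qpoch_LIMSEQ:
  assumes "norm q < 1"
  shows "(\<lambda>n. \<Prod>i<n. 1 - a * q ^ i) \<longlonglongrightarrow> qpoch_inf a q"
  using convergent_prod_LIMSEQ[OF convergent_prod_qpoch[OF assms, of a]]
  unfolding qpoch_inf_def by (simp add: LIMSEQ_lessThan_iff_atMost)

lemma power_Suc_neq_1:
  fixes q :: complex
  assumes "norm q < 1"
  shows "q ^ Suc i \<noteq> 1"
proof
  assume "q ^ Suc i = 1"
  then have "norm q ^ Suc i = 1"
    by (metis norm_one norm_power)
  then show False
    using assms power_less_one_iff[of "norm q" "Suc i"] by (metis less_irrefl norm_ge_zero zero_less_Suc)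
qed

lemma qpoch_inf_nonzero:
  assumes "norm q < 1" "norm a < 1"
  shows "qpoch_inf a q \<noteq> 0"
  unfolding qpoch_inf_def
proof (rule prodinf_nonzero[OF convergent_prod_qpoch[OF assms(1)]])
  fix i
  have "norm (a * q ^ i) \<le> norm a * 1"
    unfolding norm_mult norm_power using assms by (intro mult_left_mono power_le_one) auto
  then have "norm (a * q ^ i) < 1"
    using assms by simp
  then show "1 - a * q ^ i \<noteq> 0"
    by auto
qed

text \<open>The first n * p factors of (q;q)_inf, sorted by the residue of the index modulo p, are
  the first n factors of each product on the left, so both sides are limits of one sequence.\<close>

lemma prod_qpoch_inf_residues:
  assumes "norm q < 1" "p > 0"
  shows "(\<Prod>r<p. qpoch_inf (q ^ Suc r) (q ^ p)) = qpoch_inf q q"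
proof (rule LIMSEQ_unique)
  have "norm (q ^ p) < 1"
    using assms by (simp add: norm_power power_less_one_iff)
  then show "(\<lambda>n. \<Prod>r<p. \<Prod>i<n. 1 - q ^ Suc r * (q ^ p) ^ i)
      \<longlonglongrightarrow> (\<Prod>r<p. qpoch_inf (q ^ Suc r) (q ^ p))"
    by (intro tendsto_prod qpoch_LIMSEQ)
  have "(\<Prod>i<n * p. 1 - q * q ^ i) = (\<Prod>r<p. \<Prod>i<n. 1 - q ^ Suc r * (q ^ p) ^ i)" for n
  proof -
    have "(\<Prod>i<n * p. 1 - q * q ^ i) = (\<Prod>i<n. \<Prod>j\<in>{i * p..<i * p + p}. 1 - q * q ^ j)"
      by (rule prod.nat_group[symmetric])
    also have "\<dots> = (\<Prod>i<n. \<Prod>r<p. 1 - q ^ Suc r * (q ^ p) ^ i)"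
    proof (rule prod.cong[OF refl])
      fix i
      have "(\<Prod>j\<in>{i * p..<i * p + p}. 1 - q * q ^ j) = (\<Prod>r\<in>{0..<p}. 1 - q * q ^ (r + i * p))"
        using prod.shift_bounds_nat_ivl[of "\<lambda>j. 1 - q * q ^ j" 0 "i * p" p] by (simp add: add.commute)
      then show "(\<Prod>j\<in>{i * p..<i * p + p}. 1 - q * q ^ j) = (\<Prod>r<p. 1 - q ^ Suc r * (q ^ p) ^ i)"
        by (simp add: power_add power_mult[symmetric] mult.commute[of p] mult.assoc lessThan_atLeast0)
    qed
    also have "\<dots> = (\<Prod>r<p. \<Prod>i<n. 1 - q ^ Suc r * (q ^ p) ^ i)"
      by (rule prod.swap)
    finally show ?thesis .
  qed
  moreover have "(\<lambda>n. \<Prod>i<n * p. 1 - q * q ^ i) \<longlonglongrightarrow> qpoch_inf q q"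
    using LIMSEQ_subseq_LIMSEQ[OF qpoch_LIMSEQ[OF assms(1)], of "\<lambda>n. n * p"] assms(2)
    by (simp add: strict_mono_def o_def)
  ultimately show "(\<lambda>n. \<Prod>r<p. \<Prod>i<n. 1 - q ^ Suc r * (q ^ p) ^ i) \<longlonglongrightarrow> qpoch_inf q q"
    by simp
qed

section \<open>Gaussian binomials and the finite triple product\<close>

definition qfact :: "complex \<Rightarrow> nat \<Rightarrow> complex" where
  "qfact q n = (\<Prod>i<n. 1 - q ^ Suc i)"

text \<open>The Gaussian binomial coefficient. With an integer lower index and the value zero
  outside the range, the Pascal rules hold for every index and sums may run over all
  integers.\<close>

definition qbinom :: "complex \<Rightarrow> nat \<Rightarrow> int \<Rightarrow> complex" where
  "qbinom q n k =
     (if 0 \<le> k \<and> k \<le> int n then qfact q n / (qfact q (nat k) * qfact q (nat (int n - k))) else 0)"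

lemma qfact_nonzero: "norm q < 1 \<Longrightarrow> qfact q n \<noteq> 0"
  using power_Suc_neq_1[of q] by (auto simp: qfact_def)

lemma qfact_Suc: "qfact q (Suc n) = qfact q n * (1 - q ^ Suc n)"
  by (simp add: qfact_def)

lemma qbinom_of_nat:
  "qbinom q (a + b) (int a) = qfact q (a + b) / (qfact q a * qfact q b)"
proof -
  have "nat (int (a + b) - int a) = b" by simp
  then show ?thesis unfolding qbinom_def by (simp only: nat_int of_nat_0_le_iff of_nat_le_iff le_add1 simp_thms if_True)
qed

text \<open>The two q-Pascal rules. In the interior they come from splitting 1 - q^(a+b+2) as (1 -
  q^(b+1)) + q^(b+1) (1 - q^(a+1)), or with a and b exchanged. Where \<open>nat\<close> truncates a
  negative exponent, the binomial next to it vanishes.\<close>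

lemma qbinom_Suc:
  assumes "norm q < 1"
  shows "qbinom q (Suc n) k = qbinom q n k + q ^ nat (int n + 1 - k) * qbinom q n (k - 1)"
    and "qbinom q (Suc n) k = qbinom q n (k - 1) + q ^ nat k * qbinom q n k"
proof -
  have nz: "qfact q i \<noteq> 0" for i
    by (rule qfact_nonzero[OF assms])
  have nz': "1 - q ^ Suc i \<noteq> 0" for i
    using power_Suc_neq_1[OF assms, of i] by simp
  consider "k < 0 \<or> k > int n + 1" | "k = 0" | "k = int n + 1" | a b where "k = int (Suc a)" "n = Suc a + b"
  proof (cases "0 < k \<and> k \<le> int n")
    case True
    then show ?thesis
      by (intro that(4)[of "nat k - 1" "n - nat k"]) auto
  next
    case False
    then show ?thesis
      using that(1-3) by linarith
  qed
  then have "qbinom q (Suc n) k = qbinom q n k + q ^ nat (int n + 1 - k) * qbinom q n (k - 1) \<and>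
     qbinom q (Suc n) k = qbinom q n (k - 1) + q ^ nat k * qbinom q n k"
  proof cases
    case 1
    then show ?thesis by (auto simp: qbinom_def)
  next
    case 2
    moreover have "nat (1 + int n) = Suc n" by simp
    ultimately show ?thesis using nz by (auto simp: qbinom_def qfact_def[of q 0])
  next
    case 3
    moreover have "nat (1 + int n) = Suc n" "nat (int n + 1) = Suc n" by simp_all
    ultimately show ?thesis using nz by (auto simp: qbinom_def qfact_def[of q 0])
  next
    case (4 a b)
    have 1: "qbinom q (Suc n) k = qfact q (Suc (Suc a + b)) / (qfact q (Suc a) * qfact q (Suc b))"
      using qbinom_of_nat[of q "Suc a" "Suc b"] 4 by simp
    have 2: "qbinom q n k = qfact q (Suc (a + b)) / (qfact q (Suc a) * qfact q b)"
      using qbinom_of_nat[of q "Suc a" "b"] 4 by simp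
    have 3: "qbinom q n (k - 1) = qfact q (Suc (a + b)) / (qfact q a * qfact q (Suc b))"
      using qbinom_of_nat[of q "a" "Suc b"] 4 by simp
    have e: "nat (int n + 1 - k) = Suc b" "nat k = Suc a"
      using 4 by auto
    define A B \<alpha> \<beta> F where "A = qfact q a" and "B = qfact q b" and "\<alpha> = 1 - q ^ Suc a"
      and "\<beta> = 1 - q ^ Suc b" and "F = qfact q (Suc (a + b))"
    note defs = this
    have nonzero: "A \<noteq> 0" "B \<noteq> 0" "\<alpha> \<noteq> 0" "\<beta> \<noteq> 0"
      using nz nz' by (auto simp: defs)
    have 4: "qfact q (Suc (Suc a + b)) = F * (1 - q ^ Suc a * q ^ Suc b)"
      by (simp add: defs qfact_Suc[of q "Suc (a + b)"] power_add mult_ac)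
    have 5: "qbinom q n k = F * \<beta> / (A * \<alpha> * (B * \<beta>))"
      and 6: "qbinom q n (k - 1) = F * \<alpha> / (A * \<alpha> * (B * \<beta>))"
      using nonzero unfolding 2 3 qfact_Suc[of q a] qfact_Suc[of q b] defs[symmetric] by auto
    have 7: "1 - q ^ Suc a * q ^ Suc b = \<beta> + q ^ Suc b * \<alpha>" "1 - q ^ Suc a * q ^ Suc b = \<alpha> + q ^ Suc a * \<beta>"
      by (simp_all add: defs algebra_simps)
    have 8: "qbinom q (Suc n) k = F * (1 - q ^ Suc a * q ^ Suc b) / (A * \<alpha> * (B * \<beta>))"
      unfolding 1 4 qfact_Suc[of q a] qfact_Suc[of q b] by (simp add: defs)
    have "qbinom q (Suc n) k = qbinom q n k + q ^ Suc b * qbinom q n (k - 1)"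
      unfolding 8 5 6 7(1) by (simp only: distrib_left add_divide_distrib times_divide_eq_right mult_ac)
    moreover have "qbinom q (Suc n) k = qbinom q n (k - 1) + q ^ Suc a * qbinom q n k"
      unfolding 8 5 6 7(2) by (simp only: distrib_left add_divide_distrib times_divide_eq_right mult_ac)
    ultimately show ?thesis
      unfolding e by blast
  qed
  then show "qbinom q (Suc n) k = qbinom q n k + q ^ nat (int n + 1 - k) * qbinom q n (k - 1)"
    and "qbinom q (Suc n) k = qbinom q n (k - 1) + q ^ nat k * qbinom q n k"
    by auto
qed

text \<open>The general term of the bilateral series. As j(j-1)/2 is never negative, only the power
  of -z needs an integer exponent.\<close>

definition jterm :: "complex \<Rightarrow> complex \<Rightarrow> int \<Rightarrow> complex" where
  "jterm q z j = (- z) powi j * q ^ nat (j * (j - 1) div 2)"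

lemma nat_triangle_step:
  fixes j :: int and m :: nat
  assumes "j \<le> int m + 1"
  shows "nat ((j - 1) * (j - 1 - 1) div 2) + m = nat (j * (j - 1) div 2) + nat (int m + 1 - j)"
proof -
  have *: "j * (j - 1) div 2 = (j - 1) * (j - 1 - 1) div 2 + (j - 1)"
    by (simp add: algebra_simps)
  have "even ((j - 1) * (j - 1 - 1))" by simp
  moreover have "(j - 1) * (j - 1 - 1) \<ge> 0" "j * (j - 1) \<ge> 0"
    by (cases "j \<ge> 2"; cases "j \<le> 0"; auto simp: mult_nonneg_nonneg mult_nonpos_nonpos)+
  ultimately show ?thesis using assms * by linarith
qed

text \<open>The triangular exponent grows by j - 1 from index j - 1 to j. So the factor -z q^m moves
  a term up by one index and leaves exactly the power of q that the first q-Pascal rule asks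
  for.\<close>

lemma jterm_shift:
  assumes "z \<noteq> 0" "j \<le> int m + 1"
  shows "- z * q ^ m * jterm q z (j - 1) = jterm q z j * q ^ nat (int m + 1 - j)"
proof -
  have *: "- z * (- z) powi (j - 1) = (- z) powi j"
    using assms(1) power_int_add_1'[of "-z" "j - 1"] by simp
  have "- z * q ^ m * jterm q z (j - 1)
      = (- z * (- z) powi (j - 1)) * q ^ (nat ((j - 1) * (j - 1 - 1) div 2) + m)"
    unfolding jterm_def power_add by (simp only: mult_ac)
  also have "\<dots> = jterm q z j * q ^ nat (int m + 1 - j)"
    unfolding * nat_triangle_step[OF assms(2)] jterm_def power_add by (simp only: mult_ac)
  finally show ?thesis .
qed

lemma jterm_shift':
  assumes "z \<noteq> 0" "j \<ge> - int n - 1"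
  shows "- (q ^ Suc n / z) * jterm q z (j + 1) = jterm q z j * q ^ nat (j + int n + 1)"
proof -
  have *: "(- z) powi (j + 1) / - z = (- z) powi j"
    using assms(1) power_int_add_1[of "-z" j] by (simp add: field_simps)
  \<comment> \<open>The reflection i -> 1 - i fixes the triangular exponent, so the downward step
    follows from the upward one.\<close>
  have sym: "nat (i * (i - 1) div 2) = nat ((1 - i) * (1 - i - 1) div 2)" for i :: int
    by (simp add: algebra_simps)
  have "nat ((j + 1) * (j + 1 - 1) div 2) + Suc n = nat (j * (j - 1) div 2) + nat (j + int n + 1)"
  proof -
    have "1 - (j + 1) = 1 - j - 1" "int (Suc n) + 1 - (1 - j) = j + int n + 1" "1 - j \<le> int (Suc n) + 1"
      using assms(2) by auto
    then show ?thesis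
      using nat_triangle_step[of "1 - j" "Suc n"] sym[of j] sym[of "j + 1"] by (simp only:)
  qed
  moreover have "- (q ^ Suc n / z) * jterm q z (j + 1)
      = ((- z) powi (j + 1) / - z) * q ^ (nat ((j + 1) * (j + 1 - 1) div 2) + Suc n)"
    unfolding jterm_def power_add by simp
  ultimately show ?thesis
    unfolding * by (simp only: jterm_def power_add mult.assoc)
qed

lemma has_sum_int_shift:
  fixes f :: "int \<Rightarrow> 'a :: {topological_comm_monoid_add}"
  assumes "(f has_sum s) UNIV"
  shows "((\<lambda>j. f (j + d)) has_sum s) UNIV"
proof -
  have "bij (\<lambda>j::int. j + d)"
    by (rule o_bij[of "\<lambda>j. j - d"]) auto
  then show ?thesis
    using assms by (subst has_sum_reindex_bij_betw)
qed

text \<open>Each further factor adds a shifted multiple of the series, which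
  \<open>jterm_shift\<close> or \<open>jterm_shift'\<close> brings to the form that a q-Pascal rule
  absorbs. The base case of the induction on m is itself an induction on n.\<close>

lemma finite_jacobi_triple:
  assumes "norm q < 1" "z \<noteq> 0"
  shows "((\<lambda>j. jterm q z j * qbinom q (m + n) (int n + j)) has_sum
           (\<Prod>i<m. 1 - z * q ^ i) * (\<Prod>i<n. 1 - q / z * q ^ i)) UNIV"
proof (induction m)
  case 0
  show ?case
  proof (induction n)
    case 0
    have "qbinom q 0 j = (if j = 0 then 1 else 0)" for j
      by (auto simp: qbinom_def qfact_def)
    then show ?case
      by (intro has_sum_finite_neutralI[of "{0}"]) (auto simp: jterm_def)
  next
    case (Suc n)
    define f where "f j = jterm q z j * qbinom q (0 + n) (int n + j)" for j
    have f: "(f has_sum (\<Prod>i<n. 1 - q / z * q ^ i)) UNIV"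
      using Suc unfolding f_def by simp
    have "jterm q z j * qbinom q (0 + Suc n) (int (Suc n) + j)
        = f j + - (q ^ Suc n / z) * f (j + 1)" for j
    proof -
      have "jterm q z j * q ^ nat (j + int n + 1) * qbinom q n (j + int n + 1)
          = - (q ^ Suc n / z) * jterm q z (j + 1) * qbinom q n (j + int n + 1)"
      \<comment> \<open>Below this bound the shift lemma does not apply, but the binomial on both
        sides is zero.\<close>
      proof (cases "j \<ge> - int n - 1")
        case True
        then show ?thesis by (simp only: jterm_shift'[OF assms(2) True])
      next
        case False
        then show ?thesis by (simp add: qbinom_def)
      qed
      then show ?thesis
        using qbinom_Suc(2)[OF assms(1), of n "int (Suc n) + j"]
        unfolding f_def by (simp add: algebra_simps)
    qed
    moreover have "((\<lambda>j. f j + - (q ^ Suc n / z) * f (j + 1)) has_sum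
        (\<Prod>i<n. 1 - q / z * q ^ i) + - (q ^ Suc n / z) * (\<Prod>i<n. 1 - q / z * q ^ i)) UNIV"
      by (intro has_sum_add f has_sum_cmult_right has_sum_int_shift)
    moreover have "(\<Prod>i<n. 1 - q / z * q ^ i) + - (q ^ Suc n / z) * (\<Prod>i<n. 1 - q / z * q ^ i)
        = (\<Prod>i<0. 1 - z * q ^ i) * (\<Prod>i<Suc n. 1 - q / z * q ^ i)"
      by (simp add: algebra_simps)
    ultimately show ?case
      by (simp only:)
  qed
next
  case (Suc m)
  define P where "P = (\<Prod>i<m. 1 - z * q ^ i) * (\<Prod>i<n. 1 - q / z * q ^ i)"
  define f where "f j = jterm q z j * qbinom q (m + n) (int n + j)" for j
  have f: "(f has_sum P) UNIV"
    using Suc unfolding f_def P_def by simp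
  have "jterm q z j * qbinom q (Suc m + n) (int n + j) = f j + - z * q ^ m * f (j + -1)" for j
  proof -
    have "jterm q z j * q ^ nat (int m + 1 - j) * qbinom q (m + n) (int n + j - 1)
        = - z * q ^ m * jterm q z (j - 1) * qbinom q (m + n) (int n + j - 1)"
    proof (cases "j \<le> int m + 1")
      case True
      then show ?thesis by (simp only: jterm_shift[OF assms(2) True])
    next
      case False
      then show ?thesis by (simp add: qbinom_def)
    qed
    moreover have "nat (int (m + n) + 1 - (int n + j)) = nat (int m + 1 - j)"
      by simp
    ultimately show ?thesis
      using qbinom_Suc(1)[OF assms(1), of "m + n" "int n + j"]
      unfolding f_def by (simp add: algebra_simps)
  qed
  moreover have "((\<lambda>j. f j + - z * q ^ m * f (j + -1)) has_sum P + - z * q ^ m * P) UNIV"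
    by (intro has_sum_add f has_sum_cmult_right has_sum_int_shift)
  moreover have "P + - z * q ^ m * P = (\<Prod>i<Suc m. 1 - z * q ^ i) * (\<Prod>i<n. 1 - q / z * q ^ i)"
    by (simp add: P_def algebra_simps)
  ultimately show ?case
    by (simp only:)
qed

section \<open>Passage to the limit in the finite triple product\<close>

lemma summable_power_triangle:
  fixes r c :: real
  assumes "0 \<le> r" "r < 1" "0 \<le> c"
  shows "summable (\<lambda>k. c ^ k * r ^ (k * (k - 1) div 2))"
proof -
  \<comment> \<open>This is the ratio of consecutive terms.\<close>
  have "(\<lambda>k. r ^ k * c) \<longlonglongrightarrow> 0 * c"
    using assms by (intro tendsto_mult LIMSEQ_realpow_zero tendsto_const)
  then have "\<forall>\<^sub>F k in sequentially. r ^ k * c < 1 / 2"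
    by (intro order_tendstoD) auto
  then obtain N where N: "\<And>k. k \<ge> N \<Longrightarrow> r ^ k * c < 1 / 2"
    unfolding eventually_sequentially by blast
  show ?thesis
  proof (rule summable_ratio_test[of "1 / 2" N])
    fix k assume "k \<ge> N"
    have "Suc k * (Suc k - 1) div 2 = k * (k - 1) div 2 + k"
    proof (cases k)
      case (Suc j)
      have "Suc (Suc j) * Suc j = Suc j * j + Suc j * 2"
        by (simp add: algebra_simps)
      then show ?thesis
        unfolding Suc diff_Suc_1 by (metis div_mult_self2 mult.commute zero_neq_numeral add.commute)
    qed auto
    then have "c ^ Suc k * r ^ (Suc k * (Suc k - 1) div 2)
        = (r ^ k * c) * (c ^ k * r ^ (k * (k - 1) div 2))"
      by (simp add: power_add mult_ac)
    also have "\<dots> \<le> 1 / 2 * (c ^ k * r ^ (k * (k - 1) div 2))"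
      using N[OF \<open>k \<ge> N\<close>] assms by (intro mult_right_mono) auto
    finally show "norm (c ^ Suc k * r ^ (Suc k * (Suc k - 1) div 2))
        \<le> 1 / 2 * norm (c ^ k * r ^ (k * (k - 1) div 2))"
      using assms by simp
  qed simp
qed

lemma jterm_of_nat: "jterm q z (int k) = (- z) ^ k * q ^ (k * (k - 1) div 2)"
proof -
  have "int k * (int k - 1) = int (k * (k - 1))"
    by (cases k) (simp_all add: algebra_simps)
  then have "nat (int k * (int k - 1) div 2) = k * (k - 1) div 2"
    by (metis nat_int of_nat_numeral zdiv_int)
  then show ?thesis
    by (simp add: jterm_def)
qed

text \<open>Replacing z by q/z reverses the index, so summability over the integers reduces to
  summability over the naturals.\<close>

lemma jterm_uminus_of_nat:
  assumes "z \<noteq> 0"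
  shows "jterm q z (- int k) = jterm q (q / z) (int k)"
proof -
  have "nat (- int k * (- int k - 1) div 2) = k + k * (k - 1) div 2"
  proof (cases k)
    case (Suc j)
    have "- int k * (- int k - 1) = int (k * (k - 1) + k * 2)"
      by (simp add: Suc algebra_simps)
    then have "nat (- int k * (- int k - 1) div 2) = (k * (k - 1) + k * 2) div 2"
      by (metis nat_int of_nat_numeral zdiv_int)
    then show ?thesis by simp
  qed auto
  then have "jterm q z (- int k) = inverse (- z) ^ k * (q ^ k * q ^ (k * (k - 1) div 2))"
    unfolding jterm_def power_inverse by (simp only: power_int_minus power_add power_int_of_nat)
  also have "\<dots> = (inverse (- z) * q) ^ k * q ^ (k * (k - 1) div 2)"
    by (simp only: power_mult_distrib mult.assoc)
  also have "inverse (- z) * q = - (q / z)"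
    by (simp add: field_simps)
  finally show ?thesis
    by (simp add: jterm_of_nat)
qed

lemma jterm_abs_summable:
  assumes "norm q < 1" "z \<noteq> 0"
  shows "(\<lambda>j. norm (jterm q z j)) summable_on UNIV"
proof -
  have *: "(\<lambda>k. norm (jterm q w (int k))) summable_on UNIV" for w
    using summable_power_triangle[of "norm q" "norm w"] assms
    by (intro norm_summable_imp_summable_on)
       (simp add: jterm_of_nat norm_mult norm_power)
  have "(\<lambda>j. norm (jterm q z j)) summable_on range int"
    using * by (subst summable_on_reindex) (auto simp: o_def)
  moreover have "(\<lambda>j. norm (jterm q z j)) summable_on range (\<lambda>k. - int k)"
    using * assms by (subst summable_on_reindex) (auto simp: o_def inj_on_def jterm_uminus_of_nat)
  ultimately have "(\<lambda>j. norm (jterm q z j)) summable_on (range int \<union> range (\<lambda>k. - int k))"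
    by (rule summable_on_union)
  moreover have "j \<in> range int \<union> range (\<lambda>k. - int k)" for j
    by (cases j rule: int_cases2) auto
  then have "range int \<union> range (\<lambda>k. - int k) = UNIV"
    by blast
  ultimately show ?thesis
    by simp
qed

lemma qfact_LIMSEQ: "norm q < 1 \<Longrightarrow> qfact q \<longlonglongrightarrow> qpoch_inf q q"
  using qpoch_LIMSEQ[of q q] by (simp add: qfact_def[abs_def])

text \<open>The q-factorials converge to a nonzero limit, so they and their inverses are bounded.
  The uniform constant provides the majorant in \<open>jacobi_triple_product\<close>.\<close>

lemma qbinom_bounded:
  assumes "norm q < 1"
  shows "\<exists>C. \<forall>n k. norm (qbinom q n k) \<le> C"
proof -
  obtain A where A: "\<And>n. norm (qfact q n) \<le> A"
    using qfact_LIMSEQ[OF assms] by (meson Bseq_def convergentI convergent_imp_Bseq)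
  have "(\<lambda>n. inverse (qfact q n)) \<longlonglongrightarrow> inverse (qpoch_inf q q)"
    using qfact_LIMSEQ[OF assms] qpoch_inf_nonzero[OF assms assms] by (intro tendsto_inverse)
  then obtain B where B: "\<And>n. norm (inverse (qfact q n)) \<le> B"
    by (meson Bseq_def convergentI convergent_imp_Bseq)
  have nonneg: "0 \<le> A" "0 \<le> B"
    using A[of 0] B[of 0] norm_ge_zero order_trans by blast+
  have "norm (qbinom q n k) \<le> A * (B * B)" for n k
  proof (cases "0 \<le> k \<and> k \<le> int n")
    case True
    then have "norm (qbinom q n k) = norm (qfact q n) *
        (norm (inverse (qfact q (nat k))) * norm (inverse (qfact q (nat (int n - k)))))"
      unfolding qbinom_def norm_mult[symmetric] by (simp add: field_simps)
    also have "\<dots> \<le> A * (B * B)"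
      using nonneg by (intro mult_mono A B mult_nonneg_nonneg norm_ge_zero)
    finally show ?thesis .
  next
    case False
    then have "qbinom q n k = 0"
      by (auto simp: qbinom_def)
    then show ?thesis
      using nonneg by simp
  qed
  then show ?thesis
    by blast
qed

text \<open>All three q-factorials tend to the same limit L, and the quotient to L / L^2.\<close>

lemma qbinom_central_LIMSEQ:
  assumes "norm q < 1"
  shows "(\<lambda>n. qbinom q (n + n) (int n + j)) \<longlonglongrightarrow> 1 / qpoch_inf q q"
proof -
  define L where "L = qpoch_inf q q"
  have L: "L \<noteq> 0"
    unfolding L_def by (rule qpoch_inf_nonzero[OF assms assms])
  have shift: "filterlim (\<lambda>n. nat (int n + i)) sequentially sequentially" for i
    unfolding filterlim_at_top
  proof
    fix Z show "\<forall>\<^sub>F n in sequentially. Z \<le> nat (int n + i)"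
      by (rule eventually_sequentiallyI[of "Z + nat \<bar>i\<bar>"]) linarith
  qed
  have "filterlim (\<lambda>n::nat. n + n) sequentially sequentially"
    by (intro filterlim_subseq) (auto simp: strict_mono_def)
  note lims = this[THEN filterlim_compose[OF qfact_LIMSEQ[OF assms]]]
    shift[THEN filterlim_compose[OF qfact_LIMSEQ[OF assms]]]
  have "(\<lambda>n. qfact q (n + n) / (qfact q (nat (int n + j)) * qfact q (nat (int n + - j))))
      \<longlonglongrightarrow> L / (L * L)"
    using L unfolding L_def by (intro tendsto_divide tendsto_mult lims) auto
  moreover have "\<forall>\<^sub>F n in sequentially. qfact q (n + n) / (qfact q (nat (int n + j)) * qfact q (nat (int n + - j)))
      = qbinom q (n + n) (int n + j)"
    by (rule eventually_sequentiallyI[of "nat \<bar>j\<bar>"]) (auto simp: qbinom_def)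
  ultimately have "(\<lambda>n. qbinom q (n + n) (int n + j)) \<longlonglongrightarrow> L / (L * L)"
    by (rule Lim_transform_eventually)
  then show ?thesis
    using L by (simp add: L_def)
qed

text \<open>The finite identity with m = n, where n tends to infinity under the sum by Tannery's
  theorem. That theorem concerns series over the naturals, hence the enumeration
  \<open>int_decode\<close>.\<close>

theorem jacobi_triple_product:
  assumes "norm q < 1" "z \<noteq> 0"
  shows "(jterm q z has_sum qpochs_inf [z, q / z, q] q) UNIV"
proof -
  have bij: "bij int_decode"
    by (rule bij_int_decode)
  define L where "L = qpoch_inf q q"
  have L: "L \<noteq> 0"
    unfolding L_def by (rule qpoch_inf_nonzero[OF assms(1) assms(1)])
  define a where "a k n = jterm q z (int_decode k) * qbinom q (n + n) (int n + int_decode k)" for k n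
  define b where "b k = jterm q z (int_decode k) * (1 / L)" for k
  obtain C where C: "\<And>n k. norm (qbinom q n k) \<le> C"
    using qbinom_bounded[OF assms(1)] by blast
  define M where "M k = norm (jterm q z (int_decode k)) * C" for k
  have "(\<lambda>k. norm (jterm q z (int_decode k))) summable_on UNIV"
    using jterm_abs_summable[OF assms] bij by (subst summable_on_reindex_bij_betw)
  then have "summable M"
    unfolding M_def by (intro summable_mult2 summable_on_imp_summable)
  moreover have "(\<lambda>n. a k n) \<longlonglongrightarrow> b k" for k
    unfolding a_def b_def L_def by (intro tendsto_mult tendsto_const qbinom_central_LIMSEQ assms)
  moreover have "\<forall>\<^sub>F (k, n) in at_top \<times>\<^sub>F sequentially. norm (a k n) \<le> M k"
    unfolding a_def M_def norm_mult by (intro always_eventually) (auto intro!: mult_left_mono C)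
  ultimately have "(\<lambda>n. \<Sum>k. a k n) \<longlonglongrightarrow> suminf b"
    using tannerys_theorem[of a b sequentially M] by simp
  moreover have "(\<Sum>k. a k n) = (\<Prod>i<n. 1 - z * q ^ i) * (\<Prod>i<n. 1 - q / z * q ^ i)" for n
  proof (rule sums_unique[symmetric], rule has_sum_imp_sums)
    show "((\<lambda>k. a k n) has_sum (\<Prod>i<n. 1 - z * q ^ i) * (\<Prod>i<n. 1 - q / z * q ^ i)) UNIV"
      using finite_jacobi_triple[OF assms, of n n] bij unfolding a_def
      by (subst has_sum_reindex_bij_betw[OF bij])
  qed
  moreover have "(\<lambda>n. (\<Prod>i<n. 1 - z * q ^ i) * (\<Prod>i<n. 1 - q / z * q ^ i))
      \<longlonglongrightarrow> qpoch_inf z q * qpoch_inf (q / z) q"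
    by (intro tendsto_mult qpoch_LIMSEQ assms)
  ultimately have "suminf b = qpoch_inf z q * qpoch_inf (q / z) q"
    using LIMSEQ_unique by (simp only:) blast
  moreover have jsum: "jterm q z summable_on UNIV"
    by (rule abs_summable_summable[OF jterm_abs_summable[OF assms]])
  have "(b has_sum infsum (jterm q z) UNIV * (1 / L)) UNIV"
    unfolding b_def
    by (intro has_sum_cmult_left) (use jsum in \<open>subst has_sum_reindex_bij_betw[OF bij], simp\<close>)
  then have "suminf b = infsum (jterm q z) UNIV * (1 / L)"
    using has_sum_imp_sums sums_unique by metis
  ultimately have "infsum (jterm q z) UNIV = qpoch_inf z q * qpoch_inf (q / z) q * L"
    using L by (simp add: field_simps)
  then show ?thesis
    using jsum by (simp add: has_sum_iff qpochs_inf_def L_def mult.assoc)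
qed

section \<open>Theta series over the integers\<close>

text \<open>The support of \<open>f\<close> is the disjoint union of its parts in \<open>A\<close>
  and in the image of \<open>A\<close>, and these have equal sums.\<close>

lemma has_sum_UNIV_involution:
  fixes f :: "'a \<Rightarrow> complex"
  assumes f: "(f has_sum c) A"
    and inv: "\<And>x. i (i x) = x" "\<And>x. f (i x) = f x"
    and supp: "\<And>x. f x \<noteq> 0 \<Longrightarrow> (x \<in> A) \<noteq> (i x \<in> A)"
  shows "(f has_sum 2 * c) UNIV"
proof -
  \<comment> \<open>Points shared by \<open>A\<close> and its image can only be zeros of
    \<open>f\<close>; without them the union below is disjoint.\<close>
  define B where "B = {x \<in> A. f x \<noteq> 0}"
  have B: "(f has_sum c) B"
    using f by (subst has_sum_cong_neutral[of A B f f]) (auto simp: B_def)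
  have "(f has_sum c) (i ` B)"
    using B inv by (subst has_sum_reindex) (auto simp: o_def inj_on_def, metis)
  moreover have "B \<inter> i ` B = {}"
    using supp inv by (auto simp: B_def)
  ultimately have "(f has_sum c + c) (B \<union> i ` B)"
    using B by (intro has_sum_Un_disjoint)
  moreover have "f x = 0" if "x \<notin> B \<union> i ` B" for x
  proof (rule ccontr)
    assume "f x \<noteq> 0"
    then have "x \<in> B \<or> i x \<in> B"
      using supp[of x] inv(2)[of x] by (auto simp: B_def)
    then show False
      using that inv(1)[of x] by (metis UnI1 UnI2 imageI)
  qed
  ultimately show ?thesis
    by (subst has_sum_cong_neutral[of "B \<union> i ` B" UNIV f f]) auto
qed

lemma has_sum_half_involution:
  fixes f :: "'a \<Rightarrow> complex"
  assumes f: "(f has_sum c) UNIV"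
    and inv: "\<And>x. i (i x) = x" "\<And>x. f (i x) = f x"
    and supp: "\<And>x. f x \<noteq> 0 \<Longrightarrow> (x \<in> A) \<noteq> (i x \<in> A)"
  shows "(f has_sum c / 2) A"
proof -
  have "f summable_on A"
    using summable_on_subset[OF has_sum_imp_summable[OF f]] by simp
  then have A: "(f has_sum infsum f A) A"
    by simp
  have "2 * infsum f A = c"
    using has_sum_unique[OF has_sum_UNIV_involution[OF A inv supp] f] by blast
  then show ?thesis
    using A by auto
qed

text \<open>Over the complex numbers summability is absolute, which makes the product family
  summable; it is then summed row by row.\<close>

lemma has_sum_times:
  fixes f :: "'a \<Rightarrow> complex" and g :: "'b \<Rightarrow> complex"
  assumes f: "(f has_sum a) UNIV" and g: "(g has_sum b) UNIV"
  shows "((\<lambda>(x, y). f x * g y) has_sum a * b) UNIV"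
proof -
  have nf: "(\<lambda>x. norm (f x)) summable_on UNIV" and ng: "(\<lambda>y. norm (g y)) summable_on UNIV"
    using f g by (auto simp flip: summable_on_iff_abs_summable_on_complex intro: has_sum_imp_summable)
  have "(\<lambda>(x, y). norm (f x * g y)) summable_on UNIV \<times> UNIV"
    using nf ng
    by (intro summable_on_SigmaI[where g = "\<lambda>x. norm (f x) * infsum (\<lambda>y. norm (g y)) UNIV"])
       (auto simp: norm_mult intro!: has_sum_cmult_right summable_on_cmult_left)
  then have "(\<lambda>p. norm (case p of (x, y) \<Rightarrow> f x * g y)) summable_on UNIV \<times> UNIV"
    by (simp add: case_prod_unfold)
  then have "(\<lambda>(x, y). f x * g y) summable_on UNIV \<times> UNIV"
    by (rule abs_summable_summable)
  moreover have "((\<lambda>y. f x * g y) has_sum f x * b) UNIV" for x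
    by (intro has_sum_cmult_right g)
  moreover have "((\<lambda>x. f x * b) has_sum a * b) UNIV"
    by (intro has_sum_cmult_left f)
  ultimately have "((\<lambda>(x, y). f x * g y) has_sum a * b) (UNIV \<times> UNIV)"
    by (intro has_sum_SigmaI[where g = "\<lambda>x. f x * b"]) auto
  then show ?thesis
    by simp
qed

text \<open>Completing the square: with p = r + 2k the exponent p n(n-1)/2 + k n is n(pn - r)/2, and
  4pn(pn - r) = (2pn - r)^2 - r^2.\<close>

lemma jterm_theta:
  fixes p r k :: nat and q :: complex
  assumes "q \<noteq> 0" "p = r + 2 * k" "p > 0"
  shows "jterm (q ^ p) (q ^ k) n
    = of_int (if even n then 1 else -1) * q ^ nat (((2 * int p * n - int r)\<^sup>2 - (int r)\<^sup>2) div (8 * int p))"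
proof -
  define T where "T = n * (n - 1) div 2"
  have T: "2 * T = n * (n - 1)"
    unfolding T_def by simp
  have nonneg: "n * (n - 1) \<ge> 0"
    by (cases "n \<ge> 1") (auto simp: mult_nonneg_nonneg mult_nonpos_nonpos)
  then have "T \<ge> 0"
    using T by linarith
  define E where "E = int p * T + int k * n"
  have "2 * E = int p * (2 * T) + 2 * int k * n"
    by (simp add: E_def algebra_simps)
  also have "\<dots> = n * (int p * n - int r)"
    unfolding T using assms(2) by (simp add: algebra_simps)
  finally have E: "2 * E = n * (int p * n - int r)" .
  have "n * (int p * n - int r) \<ge> 0"
  proof (cases "n \<ge> 1")
    case True
    then have "int p * n \<ge> int p * 1"
      by (intro mult_left_mono) auto
    then show ?thesis
      using True assms(2) by (intro mult_nonneg_nonneg) auto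
  next
    case False
    then have "int p * n \<le> 0"
      by (intro mult_nonneg_nonpos) auto
    then show ?thesis
      using False by (intro mult_nonpos_nonpos) auto
  qed
  then have "E \<ge> 0"
    using E by linarith
  have "(2 * int p * n - int r)\<^sup>2 - (int r)\<^sup>2 = 4 * int p * (n * (int p * n - int r))"
    by (simp add: power2_eq_square algebra_simps)
  also have "\<dots> = 8 * int p * E"
    unfolding E[symmetric] by simp
  finally have "((2 * int p * n - int r)\<^sup>2 - (int r)\<^sup>2) div (8 * int p) = E"
    using assms(3) by simp
  moreover have "(- (q ^ k)) powi n = of_int (if even n then 1 else -1) * q powi (int k * n)"
    by (simp add: power_int_minus_left power_int_power)
  moreover have "(q ^ p) ^ nat T = q powi (int p * T)"
    using \<open>T \<ge> 0\<close> by (metis power_int_power power_int_of_nat int_nat_eq)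
  moreover have "q powi (int k * n) * q powi (int p * T) = q ^ nat E"
    using assms(1) \<open>E \<ge> 0\<close> unfolding E_def
    by (subst power_int_add[symmetric]) (auto simp: add.commute power_int_def)
  ultimately show ?thesis
    unfolding jterm_def T_def[symmetric] by (simp only: mult.assoc)
qed

text \<open>The triple product with base q^p and z = q^k as a series over all integers u. The index
  n supplies both u = 2pn - r and -u, whence the factor 2; \<open>h\<close> carries the sign as an
  even function of u.\<close>

lemma theta_has_sum:
  fixes p r k :: nat and q :: complex and h :: "int \<Rightarrow> int"
  assumes q: "norm q < 1" "q \<noteq> 0" and p: "p = r + 2 * k" "r > 0" "k > 0"
    and even: "\<And>u. h (- u) = h u"
    and val: "\<And>n. h (2 * int p * n - int r) = (if even n then 1 else -1)"
    and supp: "\<And>u. h u \<noteq> 0 \<Longrightarrow> \<exists>n. u = 2 * int p * n - int r \<or> - u = 2 * int p * n - int r"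
  shows "((\<lambda>u. of_int (h u) * q ^ nat ((u\<^sup>2 - (int r)\<^sup>2) div (8 * int p))) has_sum
           2 * qpochs_inf [q ^ k, q ^ (p - k), q ^ p] (q ^ p)) UNIV"
proof -
  let ?A = "range (\<lambda>n. 2 * int p * n - int r)"
  let ?f = "\<lambda>u. of_int (h u) * q ^ nat ((u\<^sup>2 - (int r)\<^sup>2) div (8 * int p)) :: complex"
  have "p > 0"
    using p by simp
  have "norm (q ^ p) < 1"
    using q p by (simp add: norm_power power_less_one_iff)
  then have "(jterm (q ^ p) (q ^ k) has_sum qpochs_inf [q ^ k, q ^ p / q ^ k, q ^ p] (q ^ p)) UNIV"
    using q by (intro jacobi_triple_product) auto
  moreover have "jterm (q ^ p) (q ^ k) = ?f \<circ> (\<lambda>n. 2 * int p * n - int r)"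
    by (rule ext) (simp only: o_def val jterm_theta[OF q(2) p(1) \<open>p > 0\<close>])
  moreover have "q ^ p / q ^ k = q ^ (p - k)"
    using q p(1) by (intro power_diff[symmetric]) auto
  moreover have "inj (\<lambda>n. 2 * int p * n - int r)"
    using p by (auto simp: inj_on_def)
  ultimately have "(?f has_sum qpochs_inf [q ^ k, q ^ (p - k), q ^ p] (q ^ p)) ?A"
    by (subst has_sum_reindex) auto
  then show ?thesis
  proof (rule has_sum_UNIV_involution[where i = uminus])
    fix u assume "?f u \<noteq> 0"
    then have "u \<in> ?A \<or> - u \<in> ?A"
      using supp[of u] by (auto simp: image_iff)
    \<comment> \<open>If u and -u were both of the form 2pn - r, then p would divide r, although 0 <
      r < p.\<close>
    moreover have "\<not> (u \<in> ?A \<and> - u \<in> ?A)"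
    proof
      assume "u \<in> ?A \<and> - u \<in> ?A"
      then obtain m n where "u = 2 * int p * m - int r" "- u = 2 * int p * n - int r"
        by blast
      then have "int p * (m + n) = int r"
        by (simp add: algebra_simps)
      then have "p dvd r"
        by (metis dvd_triv_left int_dvd_int_iff)
      then show False
        using p by (auto dest: dvd_imp_le)
    qed
    ultimately show "(u \<in> ?A) \<noteq> (- u \<in> ?A)"
      by blast
  qed (auto simp: even)
qed

section \<open>The identity of double sums\<close>

text \<open>\<open>chi3\<close> and \<open>chi4\<close> are the nontrivial Dirichlet characters
  modulo 3 and 4. \<open>eps5\<close> and \<open>eps7\<close> are not characters, only odd periodic
  functions supported on +-1 modulo 5 and +-2 modulo 7. The sign of a theta series is a product of
  two of the four, hence even.\<close>

definition chi3 :: "int \<Rightarrow> int" where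
  "chi3 n = (if n mod 3 = 1 then 1 else if n mod 3 = 2 then -1 else 0)"

definition chi4 :: "int \<Rightarrow> int" where
  "chi4 n = (if n mod 4 = 1 then 1 else if n mod 4 = 3 then -1 else 0)"

definition eps5 :: "int \<Rightarrow> int" where
  "eps5 n = (if n mod 5 = 1 then 1 else if n mod 5 = 4 then -1 else 0)"

definition eps7 :: "int \<Rightarrow> int" where
  "eps7 n = (if n mod 7 = 5 then 1 else if n mod 7 = 2 then -1 else 0)"

lemmas char_defs = chi3_def chi4_def eps5_def eps7_def

lemma char_uminus [simp]:
  "chi3 (- n) = - chi3 n" "chi4 (- n) = - chi4 n" "eps5 (- n) = - eps5 n" "eps7 (- n) = - eps7 n"
  unfolding char_defs by presburger+

lemma chi4_even: "even u \<Longrightarrow> chi4 u = 0"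
  unfolding chi4_def by presburger

text \<open>Between odd numbers a congruence modulo the odd number p holds modulo 2p; the sign of u
  exchanges the two classes.\<close>

lemma odd_residue_cases:
  fixes u p r :: int
  assumes "odd u" "odd p" "odd r" "p dvd u - r \<or> p dvd u + r"
  shows "\<exists>n. u = 2 * p * n - r \<or> - u = 2 * p * n - r"
  using assms(4)
proof
  assume "p dvd u - r"
  then obtain k where k: "u - r = p * k" by blast
  have "even (p * k)"
    unfolding k[symmetric] using assms by simp
  then obtain n where "k = 2 * n"
    using assms(2) by auto
  then have "- u = 2 * p * (- n) - r"
    using k by (simp add: algebra_simps)
  then show ?thesis by blast
next
  assume "p dvd u + r"
  then obtain k where k: "u + r = p * k" by blast
  have "even (p * k)"
    unfolding k[symmetric] using assms by simp
  then obtain n where "k = 2 * n"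
    using assms(2) by auto
  then have "u = 2 * p * n - r"
    using k by (simp add: algebra_simps)
  then show ?thesis by blast
qed

text \<open>This and the next five lemmas provide the hypotheses \<open>val\<close> and
  \<open>supp\<close> of \<open>theta_has_sum\<close> for (p, r) = (7, 5), (5, 1) and (3,
  1).\<close>

lemma theta7_val: "chi4 (14 * n - 5) * eps7 (14 * n - 5) = (if even n then 1 else -1)"
proof -
  have "eps7 (14 * n - 5) = -1" unfolding eps7_def by presburger
  moreover have "chi4 (14 * n - 5) = (if even n then -1 else 1)" unfolding chi4_def by presburger
  ultimately show ?thesis by simp
qed

lemma theta7_supp:
  assumes "chi4 u * eps7 u \<noteq> 0"
  shows "\<exists>n. u = 14 * n - 5 \<or> - u = 14 * n - 5"
proof -
  have "odd u"
    using assms chi4_even[of u] by auto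
  moreover have "7 dvd u - 5 \<or> 7 dvd u + 5"
    using assms mod_eq_dvd_iff[of u 7 5] mod_eq_dvd_iff[of u 7 "- 5"]
    unfolding eps7_def by (auto split: if_splits)
  ultimately show ?thesis
    using odd_residue_cases[of u 7 5] by simp
qed

lemma theta5_val: "chi4 (10 * n - 1) * eps5 (10 * n - 1) = (if even n then 1 else -1)"
proof -
  have "eps5 (10 * n - 1) = -1" unfolding eps5_def by presburger
  moreover have "chi4 (10 * n - 1) = (if even n then -1 else 1)" unfolding chi4_def by presburger
  ultimately show ?thesis by simp
qed

lemma theta5_supp:
  assumes "chi4 u * eps5 u \<noteq> 0"
  shows "\<exists>n. u = 10 * n - 1 \<or> - u = 10 * n - 1"
proof -
  have "odd u"
    using assms chi4_even[of u] by auto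
  moreover have "5 dvd u - 1 \<or> 5 dvd u + 1"
    using assms mod_eq_dvd_iff[of u 5 1] mod_eq_dvd_iff[of u 5 "- 1"]
    unfolding eps5_def by (auto split: if_splits)
  ultimately show ?thesis
    using odd_residue_cases[of u 5 1] by simp
qed

lemma theta3_val: "chi3 (6 * n - 1) * chi4 (6 * n - 1) = (if even n then 1 else -1)"
proof -
  have "chi3 (6 * n - 1) = -1" unfolding chi3_def by presburger
  moreover have "chi4 (6 * n - 1) = (if even n then -1 else 1)" unfolding chi4_def by presburger
  ultimately show ?thesis by simp
qed

lemma theta3_supp:
  assumes "chi3 u * chi4 u \<noteq> 0"
  shows "\<exists>n. u = 6 * n - 1 \<or> - u = 6 * n - 1"
proof -
  have "odd u"
    using assms chi4_even[of u] by auto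
  moreover have "3 dvd u - 1 \<or> 3 dvd u + 1"
    using assms mod_eq_dvd_iff[of u 3 1] mod_eq_dvd_iff[of u 3 "- 1"]
    unfolding chi3_def by (auto split: if_splits)
  ultimately show ?thesis
    using odd_residue_cases[of u 3 1] by simp
qed

lemma char_period:
  "chi3 (a + 3 * k) = chi3 a" "chi4 (a + 4 * k) = chi4 a"
  "eps5 (a + 5 * k) = eps5 a" "eps7 (a + 7 * k) = eps7 a"
  by (simp_all add: char_defs)

lemma chi4_add_2: "chi4 (a + 2) = - chi4 a"
  unfolding chi4_def by presburger

lemma char_square: "y mod 3 \<noteq> 0 \<Longrightarrow> chi3 y * chi3 y = 1" "odd y \<Longrightarrow> chi4 y * chi4 y = 1"
proof -
  assume "y mod 3 \<noteq> 0"
  then have "y mod 3 = 1 \<or> y mod 3 = 2"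
    by presburger
  then show "chi3 y * chi3 y = 1"
    by (auto simp: chi3_def)
next
  assume "odd y"
  then have "y mod 4 = 1 \<or> y mod 4 = 3"
    by presburger
  then show "chi4 y * chi4 y = 1"
    by (auto simp: chi4_def)
qed

text \<open>For x = 5y - 6v one has x = -y modulo 3 and x = y + 2v modulo 4. So relative to y the
  sign modulo 3 always flips, and the sign modulo 4 flips exactly for odd v.\<close>

lemma char_shift:
  fixes y v :: int
  assumes "odd y" "y mod 3 \<noteq> 0"
  shows "chi3 (5 * y - 6 * v) * chi4 (5 * y - 6 * v) * (chi3 y * chi4 y) = (if even v then -1 else 1)"
proof -
  have "chi3 (5 * y - 6 * v) = - chi3 y"
    using char_period(1)[of "- y" "2 * y - 2 * v"] by (simp add: algebra_simps)
  moreover have "chi4 (5 * y - 6 * v) = (if even v then chi4 y else - chi4 y)"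
  proof (cases "even v")
    case True
    then obtain w where "v = 2 * w" by blast
    then show ?thesis
      using char_period(2)[of y "y - 3 * w"] by (simp add: algebra_simps)
  next
    case False
    then obtain w where "v = 2 * w + 1" by (elim oddE)
    then show ?thesis
      using char_period(2)[of "y + 2" "y - 3 * w - 2"] chi4_add_2[of y] by (simp add: algebra_simps)
  qed
  moreover have "chi3 y * chi4 y * (chi3 y * chi4 y) = (chi3 y * chi3 y) * (chi4 y * chi4 y)"
    by (simp only: mult_ac)
  ultimately show ?thesis
    using char_square(1)[OF assms(2)] char_square(2)[OF assms(1)] by simp
qed

lemma chi4_mult_shift:
  fixes c b :: int
  assumes "odd c"
  shows "chi4 (c - 2 * b) * chi4 (5 * c + 2 * b) = 1"
proof -
  have "chi4 (5 * c + 2 * b) = chi4 (c - 2 * b)"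
    using char_period(2)[of "c - 2 * b" "c + b"] by (simp add: algebra_simps)
  then show ?thesis
    using char_square(2)[of "c - 2 * b"] assms by simp
qed

text \<open>The constants collect those of the theta exponents: 396 = 15 * 25 + 21 * 1 = 361 + 35 *
  1 and 840 = 15 * 56 = 21 * 40 = 35 * 24.\<close>

definition weight :: "complex \<Rightarrow> int \<Rightarrow> complex" where
  "weight q N = q ^ nat ((N - 396) div 840)"

definition prod_term :: "complex \<Rightarrow> int \<times> int \<Rightarrow> complex" where
  "prod_term q = (\<lambda>(u, v). of_int (chi4 u * eps7 u * (chi4 v * eps5 v)) * weight q (15 * u\<^sup>2 + 21 * v\<^sup>2))"

definition sum_term :: "complex \<Rightarrow> int \<times> int \<Rightarrow> complex" where
  "sum_term q = (\<lambda>(x, y). of_int (eps5 x * eps7 x * (chi3 x * chi4 x) * (chi3 y * chi4 y)) *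
     weight q (x\<^sup>2 + 35 * y\<^sup>2))"

text \<open>The common form of the terms left over on both sides. The weight is that of
  \<open>prod_term\<close> at the even pair (2a, 2b).\<close>

definition odd_term :: "complex \<Rightarrow> int \<times> int \<Rightarrow> complex" where
  "odd_term q = (\<lambda>(a, b). of_int (eps7 (5 * a) * eps5 (2 * b)) * weight q (60 * a\<^sup>2 + 84 * b\<^sup>2))"

lemma odd_term_uminus: "odd_term q (a, - b) = - odd_term q (a, b)"
proof -
  have "eps5 (2 * - b) = - eps5 (2 * b)"
    using char_uminus(3)[of "2 * b"] by simp
  then show ?thesis
    by (simp add: odd_term_def)
qed

text \<open>The substitution with u = 2y - v, for which (5u - 7v)/2 = 5y - 6v and (u + v)/2 =
  y.\<close>

lemma sum_term_eq_prod_term: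
  assumes "odd y" "odd v" "y mod 3 \<noteq> 0"
  shows "sum_term q (5 * y - 6 * v, y) = prod_term q (2 * y - v, v)"
proof -
  obtain w where w: "y = 2 * w + 1"
    using assms(1) by (elim oddE)
  have "chi4 (2 * y - v) = chi4 v"
    using char_period(2)[of "- v + 2" w] chi4_add_2[of "- v"] by (simp add: w algebra_simps)
  then have "chi4 (2 * y - v) * chi4 v = 1"
    using char_square(2)[OF assms(2)] by simp
  moreover have "eps5 (5 * y - 6 * v) = - eps5 v"
    using char_period(3)[of "- v" "y - v"] by (simp add: algebra_simps)
  moreover have "eps7 (5 * y - 6 * v) = - eps7 (2 * y - v)"
    using char_period(4)[of "- (2 * y - v)" "y - v"] char_uminus(4)[of "2 * y - v"]
    by (simp add: algebra_simps)
  moreover note char_shift[OF assms(1,3), of v]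
  moreover have "chi4 (2 * y - v) * eps7 (2 * y - v) * (chi4 v * eps5 v)
      = (chi4 (2 * y - v) * chi4 v) * (eps5 v * eps7 (2 * y - v))"
    by (simp only: mult_ac)
  ultimately have "eps5 (5 * y - 6 * v) * eps7 (5 * y - 6 * v) *
      (chi3 (5 * y - 6 * v) * chi4 (5 * y - 6 * v)) * (chi3 y * chi4 y)
    = chi4 (2 * y - v) * eps7 (2 * y - v) * (chi4 v * eps5 v)"
    using assms(2) by (simp add: mult.assoc)
  moreover have "(5 * y - 6 * v)\<^sup>2 + 35 * y\<^sup>2 = 15 * (2 * y - v)\<^sup>2 + 21 * v\<^sup>2"
    by (simp add: power2_eq_square algebra_simps)
  ultimately show ?thesis
    by (simp only: sum_term_def prod_term_def prod.case)
qed

lemma sum_term_eq_0: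
  assumes "even y \<or> y mod 3 = 0"
  shows "sum_term q (x, y) = 0"
proof -
  have "chi3 y = 0 \<or> chi4 y = 0"
    using assms chi4_even[of y] by (auto simp: chi3_def)
  then show ?thesis
    by (auto simp: sum_term_def)
qed

text \<open>The same substitution at the even pair u = 2a, v = 2b.\<close>

lemma sum_term_eq_odd_term:
  assumes "odd (a + b)" "(a + b) mod 3 \<noteq> 0"
  shows "sum_term q (5 * a - 7 * b, a + b) = odd_term q (a, b)"
proof -
  define x where "x = 5 * a - 7 * b"
  have "eps5 x = - eps5 (2 * b)"
    using char_period(3)[of "- (2 * b)" "a - b"] char_uminus(3)[of "2 * b"]
    by (simp add: x_def algebra_simps)
  moreover have "eps7 x = eps7 (5 * a)"
    using char_period(4)[of "5 * a" "- b"] by (simp add: x_def algebra_simps)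
  moreover have "chi3 x * chi4 x * (chi3 (a + b) * chi4 (a + b)) = -1"
    using char_shift[OF assms, of "2 * b"] by (simp add: x_def algebra_simps)
  ultimately have "eps5 x * eps7 x * (chi3 x * chi4 x) * (chi3 (a + b) * chi4 (a + b))
    = eps7 (5 * a) * eps5 (2 * b)"
    by (simp add: mult.assoc)
  moreover have "x\<^sup>2 + 35 * (a + b)\<^sup>2 = 60 * a\<^sup>2 + 84 * b\<^sup>2"
    by (simp add: x_def power2_eq_square algebra_simps)
  ultimately show ?thesis
    unfolding x_def[symmetric] by (simp only: sum_term_def odd_term_def prod.case)
qed

text \<open>These are the product terms with y = 3c. A rational automorphism of 15u^2 + 21v^2 sends
  the even pair (2a, 2b) to ((a - 7b)/3, (5a + b)/3), which is integral when a = b + 3c.\<close>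

lemma prod_term_eq_odd_term:
  assumes "odd c"
  shows "prod_term q (c - 2 * b, 5 * c + 2 * b) = odd_term q (b + 3 * c, b)"
proof -
  have "eps7 (c - 2 * b) = eps7 (5 * (b + 3 * c))"
    using char_period(4)[of "c - 2 * b" "b + 2 * c"] by (simp add: algebra_simps)
  moreover have "eps5 (5 * c + 2 * b) = eps5 (2 * b)"
    using char_period(3)[of "2 * b" c] by (simp add: algebra_simps)
  ultimately have "chi4 (c - 2 * b) * eps7 (c - 2 * b) * (chi4 (5 * c + 2 * b) * eps5 (5 * c + 2 * b))
    = (chi4 (c - 2 * b) * chi4 (5 * c + 2 * b)) * (eps7 (5 * (b + 3 * c)) * eps5 (2 * b))"
    by simp
  moreover have "15 * (c - 2 * b)\<^sup>2 + 21 * (5 * c + 2 * b)\<^sup>2 = 60 * (b + 3 * c)\<^sup>2 + 84 * b\<^sup>2"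
    by (simp add: power2_eq_square algebra_simps)
  ultimately show ?thesis
    using chi4_mult_shift[OF assms, of b]
    by (simp only: prod_term_def odd_term_def prod.case mult_1)
qed

text \<open>The term is even in v. For odd u and v the numbers u + v and u - v differ by 2 modulo 4,
  so exactly one sign of v makes y = (u + v)/2 odd.\<close>

lemma prod_term_has_sum_odd:
  assumes "(prod_term q has_sum \<alpha>) UNIV"
  shows "((\<lambda>(y, v). prod_term q (2 * y - v, v)) has_sum \<alpha> / 2) {(y, v). odd y \<and> odd v}"
proof -
  have "(prod_term q has_sum \<alpha> / 2) {(u, v). odd v \<and> (u + v) mod 4 = 2}"
  proof (rule has_sum_half_involution[OF assms, where i = "\<lambda>(u, v). (u, - v)"])
    fix p assume *: "prod_term q p \<noteq> 0"
    obtain u v where p: "p = (u, v)" by force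
    have "chi4 u \<noteq> 0" "chi4 v \<noteq> 0"
      using * by (auto simp: p prod_term_def)
    then have "odd u" "odd v"
      using chi4_even by blast+
    then obtain k l where "u = 2 * k + 1" "v = 2 * l + 1"
      by (meson oddE)
    then have "(u + v) mod 4 = 2 \<longleftrightarrow> \<not> (u - v) mod 4 = 2"
      by presburger
    then show "(p \<in> {(u, v). odd v \<and> (u + v) mod 4 = 2})
        \<noteq> ((case p of (u, v) \<Rightarrow> (u, - v)) \<in> {(u, v). odd v \<and> (u + v) mod 4 = 2})"
      using \<open>odd v\<close> by (simp add: p)
  qed (auto simp: prod_term_def)
  then show ?thesis
  proof (subst has_sum_reindex_bij_witness[where i = "\<lambda>(u, v). ((u + v) div 2, v)"
        and j = "\<lambda>(y, v). (2 * y - v, v)" and h = "prod_term q"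
        and T = "{(u, v). odd v \<and> (u + v) mod 4 = 2}" and s' = "\<alpha> / 2"])
    fix p :: "int \<times> int" assume "p \<in> {(y, v). odd y \<and> odd v}"
    then show "(case p of (y, v) \<Rightarrow> (2 * y - v, v)) \<in> {(u, v). odd v \<and> (u + v) mod 4 = 2}"
      by (auto elim!: oddE)
  next
    fix p :: "int \<times> int" assume "p \<in> {(u, v). odd v \<and> (u + v) mod 4 = 2}"
    then obtain u v where p: "p = (u, v)" "odd v" "(u + v) mod 4 = 2"
      by auto
    define k where "k = (u + v) div 4"
    have k: "u + v = 4 * k + 2"
      using mult_div_mod_eq[of 4 "u + v"] p(3) unfolding k_def by linarith
    then have y: "(u + v) div 2 = 2 * k + 1"
      by simp
    then show "(case case p of (u, v) \<Rightarrow> ((u + v) div 2, v) of (y, v) \<Rightarrow> (2 * y - v, v)) = p"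
      using k by (simp add: p)
    show "(case p of (u, v) \<Rightarrow> ((u + v) div 2, v)) \<in> {(y, v). odd y \<and> odd v}"
      using y p by simp
  qed auto
qed

text \<open>The term is even in y. Where it is nonzero, x and y are +-1 modulo 6, so exactly one
  sign of y makes v = (5y - x)/6 an integer.\<close>

lemma sum_term_has_sum:
  assumes "(sum_term q has_sum \<beta>) UNIV"
  shows "((\<lambda>(y, v). sum_term q (5 * y - 6 * v, y)) has_sum \<beta> / 2) UNIV"
proof -
  have "(sum_term q has_sum \<beta> / 2) {(x, y). 6 dvd 5 * y - x}"
  proof (rule has_sum_half_involution[OF assms, where i = "\<lambda>(x, y). (x, - y)"])
    fix p assume *: "sum_term q p \<noteq> 0"
    obtain x y where p: "p = (x, y)" by force
    have "chi3 x * chi4 x \<noteq> 0" "chi3 y * chi4 y \<noteq> 0"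
      using * by (auto simp: p sum_term_def)
    then obtain m n where "x = 6 * m - 1 \<or> - x = 6 * m - 1" "y = 6 * n - 1 \<or> - y = 6 * n - 1"
      using theta3_supp by metis
    then have "6 dvd 5 * y - x \<longleftrightarrow> \<not> 6 dvd 5 * (- y) - x"
      by (elim disjE) presburger+
    then show "(p \<in> {(x, y). 6 dvd 5 * y - x})
        \<noteq> ((case p of (x, y) \<Rightarrow> (x, - y)) \<in> {(x, y). 6 dvd 5 * y - x})"
      by (simp add: p)
  qed (auto simp: sum_term_def)
  then show ?thesis
    by (subst has_sum_reindex_bij_witness[where i = "\<lambda>(x, y). (y, (5 * y - x) div 6)"
        and j = "\<lambda>(y, v). (5 * y - 6 * v, y)" and h = "sum_term q"
        and T = "{(x, y). 6 dvd 5 * y - x}" and s' = "\<beta> / 2"]) auto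
qed

text \<open>
  The flip \<open>b \<mapsto> -b\<close> negates the summand and exchanges the classes \<open>a \<equiv> b\<close> and \<open>a \<equiv> -b\<close>
  modulo \<open>3\<close>, so the sums over \<open>a \<equiv> b\<close> and over the complement of \<open>a \<equiv> -b\<close> agree.
\<close>
lemma odd_term_sums_eq:
  assumes w: "(odd_term q has_sum w) {(a, b). odd (a + b) \<and> (a + b) mod 3 \<noteq> 0}"
    and k: "(odd_term q has_sum k) {(a, b). odd (a + b) \<and> (a - b) mod 3 = 0}"
  shows "w = k"
proof -
  have flip: "(odd_term q has_sum - s) B"
    if "(odd_term q has_sum s) A" "B = {(a, b). (a, - b) \<in> A}" for s A B
  proof -
    have "((\<lambda>p. - odd_term q p) has_sum - s) A"
      using that(1) by (simp add: has_sum_uminus)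
    then show ?thesis
      by (subst has_sum_reindex_bij_witness[where i = "\<lambda>(a, b). (a, - b)" and j = "\<lambda>(a, b). (a, - b)"
            and h = "\<lambda>p. - odd_term q p" and T = A and s' = "- s"])
         (auto simp: that(2) odd_term_uminus)
  qed
  have "(odd_term q has_sum - k) {(a, b). odd (a + b) \<and> (a + b) mod 3 = 0}"
    by (rule flip[OF k]) auto
  with w have "(odd_term q has_sum w + - k) ({(a, b). odd (a + b) \<and> (a + b) mod 3 \<noteq> 0} \<union>
      {(a, b). odd (a + b) \<and> (a + b) mod 3 = 0})"
    by (rule has_sum_Un_disjoint) auto
  also have "{(a, b). odd (a + b) \<and> (a + b) mod 3 \<noteq> 0} \<union> {(a, b). odd (a + b) \<and> (a + b) mod 3 = 0}
      = {(a, b). odd (a + b :: int)}"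
    by auto
  finally have sum: "(odd_term q has_sum w + - k) {(a, b). odd (a + b)}" .
  \<comment> \<open>All pairs with odd a + b form a set stable under the flip, so the sum w - k is
    its own negative.\<close>
  have "(odd_term q has_sum - (w + - k)) {(a, b). odd (a + b)}"
    by (rule flip[OF sum]) auto
  from has_sum_unique[OF sum this] show ?thesis
    by simp
qed

lemma prod_sum_eq_sum_sum:
  assumes "(prod_term q has_sum \<alpha>) UNIV" "(sum_term q has_sum \<beta>) UNIV"
  shows "\<alpha> = \<beta>"
proof -
  define W where "W = (\<lambda>(y, v). sum_term q (5 * y - 6 * v, y))"
  define F where "F = (\<lambda>(y, v). prod_term q (2 * y - v, v))"
  \<comment> \<open>\<open>X1\<close> indexes the matched terms, \<open>X2\<close> the leftover of
    the product (3 divides y), \<open>X3\<close> the leftover of the series (v even). Outside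
    \<open>X1\<close> and \<open>X3\<close> the function \<open>W\<close> vanishes.\<close>
  define X1 :: "(int \<times> int) set" where "X1 = {(y, v). odd y \<and> odd v \<and> y mod 3 \<noteq> 0}"
  define X2 :: "(int \<times> int) set" where "X2 = {(y, v). odd y \<and> odd v \<and> y mod 3 = 0}"
  define X3 :: "(int \<times> int) set" where "X3 = {(y, v). odd y \<and> even v \<and> y mod 3 \<noteq> 0}"
  have W: "(W has_sum \<beta> / 2) UNIV"
    unfolding W_def by (rule sum_term_has_sum[OF assms(2)])
  have "{(y, v). odd y \<and> odd v} = X1 \<union> X2"
    by (auto simp: X1_def X2_def)
  then have F: "(F has_sum \<alpha> / 2) (X1 \<union> X2)"
    using prod_term_has_sum_odd[OF assms(1)] unfolding F_def by simp
  have "F summable_on X1" "F summable_on X2"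
    using has_sum_imp_summable[OF F] by (rule summable_on_subset; simp)+
  then obtain m k where m: "(F has_sum m) X1" and k: "(F has_sum k) X2"
    by (auto simp: summable_on_def)
  have "W summable_on X3"
    using has_sum_imp_summable[OF W] by (rule summable_on_subset) simp
  then obtain w where w: "(W has_sum w) X3"
    by (auto simp: summable_on_def)
  have "(F has_sum m + k) (X1 \<union> X2)"
    using m k by (rule has_sum_Un_disjoint) (auto simp: X1_def X2_def)
  then have \<alpha>: "\<alpha> / 2 = m + k"
    using F has_sum_unique by blast
  have "(W has_sum m) X1"
    using m by (subst has_sum_cong[of X1 W F])
      (auto simp: X1_def W_def F_def sum_term_eq_prod_term)
  then have "(W has_sum m + w) (X1 \<union> X3)"
    using w by (rule has_sum_Un_disjoint) (auto simp: X1_def X3_def)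
  moreover have "(W has_sum m + w) (X1 \<union> X3) \<longleftrightarrow> (W has_sum m + w) UNIV"
    by (rule has_sum_cong_neutral) (auto simp: X1_def X3_def W_def intro!: sum_term_eq_0)
  ultimately have \<beta>: "\<beta> / 2 = m + w"
    using W has_sum_unique by blast
  have "(odd_term q has_sum w) {(a, b). odd (a + b) \<and> (a + b) mod 3 \<noteq> 0}"
    using w
    by (subst has_sum_reindex_bij_witness[where i = "\<lambda>(y, v). (y - v div 2, v div 2)"
          and j = "\<lambda>(a, b). (a + b, 2 * b)" and h = W and T = X3 and s' = w])
       (auto simp: X3_def W_def intro!: sum_term_eq_odd_term)
  \<comment> \<open>On \<open>X2\<close> put y = 3c, v = 5c + 2b and a = b + 3c; since c and v are
    odd, b is an integer.\<close>
  moreover have "(odd_term q has_sum k) {(a, b). odd (a + b) \<and> (a - b) mod 3 = 0}"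
    using k
  proof (subst has_sum_reindex_bij_witness[where i = "\<lambda>(y, v). ((v - 5 * (y div 3)) div 2 + y, (v - 5 * (y div 3)) div 2)"
          and j = "\<lambda>(a, b). (a - b, 5 * ((a - b) div 3) + 2 * b)" and h = F and T = X2 and s' = k])
    fix p :: "int \<times> int" assume "p \<in> {(a, b). odd (a + b) \<and> (a - b) mod 3 = 0}"
    then obtain a b where p: "p = (a, b)" "odd (a + b)" "(a - b) mod 3 = 0"
      by auto
    define c where "c = (a - b) div 3"
    have c: "a - b = 3 * c"
      using p(3) unfolding c_def by auto
    then have a: "a = b + 3 * c"
      by simp
    have "odd c"
      using p(2) by (simp add: a)
    then show "(case p of (a, b) \<Rightarrow> (a - b, 5 * ((a - b) div 3) + 2 * b)) \<in> X2"
      by (simp add: X2_def p a)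
    show "F (case p of (a, b) \<Rightarrow> (a - b, 5 * ((a - b) div 3) + 2 * b)) = odd_term q p"
      using prod_term_eq_odd_term[OF \<open>odd c\<close>, of q b]
      by (simp add: p a F_def algebra_simps)
    show "(case case p of (a, b) \<Rightarrow> (a - b, 5 * ((a - b) div 3) + 2 * b) of
        (y, v) \<Rightarrow> ((v - 5 * (y div 3)) div 2 + y, (v - 5 * (y div 3)) div 2)) = p"
      by (simp add: p)
  next
    fix p assume "p \<in> X2"
    then obtain c v where p: "p = (3 * c, v)" "odd c" "odd v"
      by (auto simp: X2_def elim!: dvdE)
    have "even (v - 5 * c)"
      using p by simp
    then obtain d where d: "v - 5 * c = 2 * d"
      by blast
    then have v: "v = 5 * c + 2 * d"
      by simp
    show "(case case p of (y, v) \<Rightarrow> ((v - 5 * (y div 3)) div 2 + y, (v - 5 * (y div 3)) div 2) of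
        (a, b) \<Rightarrow> (a - b, 5 * ((a - b) div 3) + 2 * b)) = p"
      by (simp add: p v)
    show "(case p of (y, v) \<Rightarrow> ((v - 5 * (y div 3)) div 2 + y, (v - 5 * (y div 3)) div 2))
        \<in> {(a, b). odd (a + b) \<and> (a - b) mod 3 = 0}"
      using p(2) by (simp add: p(1) v)
  qed auto
  ultimately have "w = k"
    by (rule odd_term_sums_eq)
  then show ?thesis
    using \<alpha> \<beta> by simp
qed

section \<open>The square roots of 361 modulo 840\<close>

text \<open>The sign that the variable x contributes to \<open>sum_term\<close>; being a product of
  four odd functions, it is even.\<close>

definition root_sign :: "int \<Rightarrow> int" where
  "root_sign x = eps5 x * eps7 x * (chi3 x * chi4 x)"

text \<open>The solutions of r^2 = 361 modulo 840 below 420. The period is 420 because (x + 420)^2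
  and x^2 agree modulo 840; its 16 solutions explain the modulus in \<open>t\<close>.\<close>

definition root_residues :: "nat list" where
  "root_residues = [19, 61, 79, 89, 121, 131, 149, 191, 229, 271, 289, 299, 331, 341, 359, 401]"

definition root_seq :: "nat \<Rightarrow> nat" where
  "root_seq n = 420 * (n div 16) + root_residues ! (n mod 16)"

lemma root_sign_uminus [simp]: "root_sign (- x) = root_sign x"
  by (simp add: root_sign_def)

lemma root_sign_mod: "root_sign (x mod 420) = root_sign x"
  by (simp add: root_sign_def char_defs mod_mod_cancel)

text \<open>Evaluated over one full period. Both conditions say that r is prime to 6, +-1 modulo 5
  and +-2 modulo 7, since 361 is 1 modulo 3, 5 and 8 and is 4 modulo 7.\<close>

lemma root_residues_int_check:
  "\<forall>r\<in>set [0..419]. let m = r \<in> set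
     [19, 61, 79, 89, 121, 131, 149, 191, 229, 271, 289, 299, 331, 341, 359, 401]
   in (root_sign r \<noteq> 0 \<longleftrightarrow> m) \<and> (r * r mod 840 = 361 \<longleftrightarrow> m)"
  by code_simp

lemma root_residues_check:
  assumes "r < 420"
  shows "root_sign (int r) \<noteq> 0 \<longleftrightarrow> r \<in> set root_residues"
    and "r\<^sup>2 mod 840 = 361 \<longleftrightarrow> r \<in> set root_residues"
proof -
  have "int r \<in> set [0..419]"
    using assms by simp
  moreover have "int r \<in> set [19, 61, 79, 89, 121, 131, 149, 191, 229, 271, 289, 299, 331, 341, 359, 401]
      \<longleftrightarrow> r \<in> set root_residues"
    by (simp add: root_residues_def)
  ultimately have *: "root_sign (int r) \<noteq> 0 \<longleftrightarrow> r \<in> set root_residues"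
      "int r * int r mod 840 = 361 \<longleftrightarrow> r \<in> set root_residues"
    using root_residues_int_check by (simp_all only: Let_def)
  have "int r * int r mod 840 = int (r\<^sup>2 mod 840)"
    by (simp add: power2_eq_square zmod_int)
  then show "root_sign (int r) \<noteq> 0 \<longleftrightarrow> r \<in> set root_residues"
    and "r\<^sup>2 mod 840 = 361 \<longleftrightarrow> r \<in> set root_residues"
    using * by auto
qed

lemma less_16_cases:
  assumes "m < (16 :: nat)"
  obtains "m = 0" | "m = 1" | "m = 2" | "m = 3" | "m = 4" | "m = 5" | "m = 6" | "m = 7"
    | "m = 8" | "m = 9" | "m = 10" | "m = 11" | "m = 12" | "m = 13" | "m = 14" | "m = 15"
proof -
  from assms have "m = 0 \<or> m = 1 \<or> m = 2 \<or> m = 3 \<or> m = 4 \<or> m = 5 \<or> m = 6 \<or> m = 7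
      \<or> m = 8 \<or> m = 9 \<or> m = 10 \<or> m = 11 \<or> m = 12 \<or> m = 13 \<or> m = 14 \<or> m = 15"
    by (auto simp: numeral_eq_Suc less_Suc_eq)
  then show thesis
    using that by blast
qed

lemma root_residues_sorted: "m < 15 \<Longrightarrow> root_residues ! m < root_residues ! Suc m"
  by (cases m rule: less_16_cases) (simp_all add: root_residues_def)

lemma root_residues_less: "m < 16 \<Longrightarrow> root_residues ! m < 420"
  by (cases m rule: less_16_cases) (simp_all add: root_residues_def)

lemma root_residues_sign: "m < 16 \<Longrightarrow> root_sign (int (root_residues ! m)) = (-1) ^ t m"
  by (cases m rule: less_16_cases)
     (simp_all add: root_residues_def root_sign_def char_defs t_def)

lemma set_root_residues: "set root_residues = (\<lambda>m. root_residues ! m) ` {..<16}"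
  by (auto simp: set_conv_nth root_residues_def)

lemma root_seq_mod: "root_seq n mod 420 = root_residues ! (n mod 16)"
  using root_residues_less by (simp add: root_seq_def)

lemma strict_mono_root_seq: "strict_mono root_seq"
proof (rule strict_mono_Suc_iff[THEN iffD2], rule allI)
  fix n
  show "root_seq n < root_seq (Suc n)"
  proof (cases "n mod 16 = 15")
    case True
    then have "Suc n mod 16 = 0" "Suc n div 16 = Suc (n div 16)"
      by (auto simp: mod_Suc div_Suc)
    then show ?thesis
      using root_residues_less by (simp add: root_seq_def True trans_less_add1)
  next
    case False
    then have *: "Suc n mod 16 = Suc (n mod 16)" "Suc n div 16 = n div 16"
      by (auto simp: mod_Suc div_Suc)
    have "n mod 16 < 15"
      using False mod_less_divisor[of 16 n] by linarith
    then show ?thesis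
      using root_residues_sorted by (simp add: root_seq_def *)
  qed
qed

lemma range_root_seq: "range root_seq = {x. x mod 420 \<in> set root_residues}"
proof (intro equalityI subsetI)
  fix x assume "x \<in> range root_seq"
  then obtain n where "x = root_seq n" by blast
  then show "x \<in> {x. x mod 420 \<in> set root_residues}"
    by (simp add: root_seq_mod set_root_residues)
next
  fix x assume "x \<in> {x. x mod 420 \<in> set root_residues}"
  then obtain m where m: "m < 16" "x mod 420 = root_residues ! m"
    by (auto simp: set_root_residues)
  have "x = root_seq (16 * (x div 420) + m)"
    using m by (simp add: root_seq_def flip: m(2))
  then show "x \<in> range root_seq"
    by blast
qed

lemma square_mod_840: "x\<^sup>2 mod 840 = (x mod 420)\<^sup>2 mod (840 :: nat)"
proof -
  define k r where "k = x div 420" and "r = x mod 420"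
  have "x = 420 * k + r"
    by (simp add: k_def r_def)
  then have "x\<^sup>2 = r\<^sup>2 + 840 * (210 * k\<^sup>2 + k * r)"
    by (simp add: power2_eq_square algebra_simps)
  then show ?thesis
    unfolding r_def[symmetric] by (simp only: mod_mult_self2)
qed

lemma mem_range_root_seq_iff: "x \<in> range root_seq \<longleftrightarrow> x\<^sup>2 mod 840 = 361"
  using root_residues_check(2)[of "x mod 420"] by (simp add: range_root_seq square_mod_840[of x])

lemma root_sign_nonzero_iff: "root_sign (int x) \<noteq> 0 \<longleftrightarrow> x \<in> range root_seq"
proof -
  have "root_sign (int x) = root_sign (int (x mod 420))"
    using root_sign_mod[of "int x"] by (simp add: zmod_int)
  then show ?thesis
    using root_residues_check(1)[of "x mod 420"] by (simp add: range_root_seq)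
qed

lemma root_sign_root_seq: "root_sign (int (root_seq n)) = (-1) ^ t n"
proof -
  have "root_sign (int (root_seq n)) = root_sign (int (root_seq n mod 420))"
    using root_sign_mod[of "int (root_seq n)"] by (simp add: zmod_int)
  also have "\<dots> = (-1) ^ t (n mod 16)"
    using root_residues_sign by (simp add: root_seq_mod)
  also have "t (n mod 16) = t n"
    by (simp add: t_def)
  finally show ?thesis .
qed

section \<open>Matching the roots with the exponents in increasing order\<close>

lemma strict_mono_range_unique:
  fixes f g :: "nat \<Rightarrow> nat"
  assumes "strict_mono f" "strict_mono g" "range f = range g"
  shows "f = g"
proof
  \<comment> \<open>If f and g agree below n, the index m with f n = g m is not below n, so g n
    \<le> g m = f n. Exchanging f and g gives equality.\<close>
  have le: "g n \<le> f n" if f: "strict_mono f" and g: "strict_mono g" and range: "range f = range g"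
      and eq: "\<And>m. m < n \<Longrightarrow> f m = g m"
    for f g :: "nat \<Rightarrow> nat" and n
  proof -
    obtain m where m: "f n = g m"
      using range by blast
    have "\<not> m < n"
    proof
      assume "m < n"
      then have "f m = f n"
        using eq m by simp
      then show False
        using strict_mono_less[OF f] \<open>m < n\<close> by (metis less_irrefl)
    qed
    then show ?thesis
      using m strict_mono_less_eq[OF g] by (metis not_less)
  qed
  fix n
  show "f n = g n"
  proof (induction n rule: less_induct)
    case (less n)
    then show ?case
      using le[of f g n] le[of g f n] assms by (metis le_antisym)
  qed
qed

text \<open>The quotients \<open>e n\<close> increase and exhaust \<open>exponents\<close>, as
  \<open>a_seq\<close> does, so the two enumerations coincide.\<close>

lemma square_root_seq: "(root_seq n)\<^sup>2 = 840 * a_seq n + 361"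
proof -
  define e where "e n = ((root_seq n)\<^sup>2 - 361) div 840" for n
  have e: "(root_seq n)\<^sup>2 = 840 * e n + 361" for n
  proof -
    have "(root_seq n)\<^sup>2 mod 840 = 361"
      using mem_range_root_seq_iff by blast
    then obtain d where d: "(root_seq n)\<^sup>2 = 840 * d + 361"
      by (metis mult_div_mod_eq)
    then show ?thesis
      unfolding e_def d by simp
  qed
  have "e = a_seq"
  proof (rule strict_mono_range_unique)
    show "strict_mono e"
    proof (rule strict_monoI)
      fix m n :: nat assume "m < n"
      then have "(root_seq m)\<^sup>2 < (root_seq n)\<^sup>2"
        using strict_mono_root_seq by (intro power_strict_mono) (auto simp: strict_mono_def)
      then show "e m < e n"
        unfolding e by simp
    qed
    have "range e = exponents"
    proof (intro equalityI subsetI)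
      fix m assume "m \<in> range e"
      then show "m \<in> exponents"
        using e by (auto simp: exponents_def is_nth_power_def) metis
    next
      fix m assume "m \<in> exponents"
      then obtain x where x: "840 * m + 361 = x\<^sup>2"
        by (auto simp: exponents_def is_nth_power_def)
      have "x\<^sup>2 mod 840 = 361"
        unfolding x[symmetric] by simp
      then obtain n where "x = root_seq n"
        using mem_range_root_seq_iff by blast
      then have "m = e n"
        using x e[of n] by simp
      then show "m \<in> range e"
        by blast
    qed
    then show "range e = range a_seq"
      by (simp add: range_a_seq)
  qed (rule strict_mono_a_seq)
  then show ?thesis
    using e[of n] by simp
qed

lemma a_seq_summable:
  fixes q :: complex
  assumes "norm q < 1"
  shows "(\<lambda>n. (-1) ^ t n * q ^ a_seq n) summable_on UNIV"
proof (rule norm_summable_imp_summable_on)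
  have "norm q ^ a_seq n \<le> norm q ^ n" for n
    using assms strict_mono_imp_increasing[OF strict_mono_a_seq] by (intro power_decreasing) auto
  then show "summable (\<lambda>n. norm ((-1) ^ t n * q ^ a_seq n))"
    using assms by (intro summable_comparison_test'[OF summable_geometric[of "norm q"]])
      (auto simp: norm_mult norm_power)
qed

text \<open>Each exponent arises from the two roots +-\<open>root_seq n\<close>, and
  \<open>root_sign\<close> vanishes at all other integers.\<close>

lemma root_has_sum:
  fixes q :: complex
  assumes "((\<lambda>n. (-1) ^ t n * q ^ a_seq n) has_sum S) UNIV"
  shows "((\<lambda>x. of_int (root_sign x) * q ^ nat ((x\<^sup>2 - 361) div 840)) has_sum 2 * S) UNIV"
proof (rule has_sum_UNIV_involution[where i = uminus])
  let ?A = "range (\<lambda>n. int (root_seq n))"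
  let ?f = "\<lambda>x. of_int (root_sign x) * q ^ nat ((x\<^sup>2 - 361) div 840) :: complex"
  have "(int (root_seq n))\<^sup>2 = 840 * int (a_seq n) + 361" for n
    using arg_cong[OF square_root_seq[of n], of int] by simp
  then have "?f \<circ> (\<lambda>n. int (root_seq n)) = (\<lambda>n. (-1) ^ t n * q ^ a_seq n)"
    by (simp add: fun_eq_iff root_sign_root_seq)
  moreover have "inj (\<lambda>n. int (root_seq n))"
    using strict_mono_imp_inj_on[OF strict_mono_root_seq] by (auto simp: inj_def)
  ultimately show "(?f has_sum S) ?A"
    using assms by (subst has_sum_reindex) auto
  fix x assume "?f x \<noteq> 0"
  then have nz: "root_sign x \<noteq> 0"
    by auto
  then have "x \<noteq> 0"
    by (auto simp: root_sign_def char_defs)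
  have pos: "root_seq n > 0" for n
    using square_root_seq[of n] by (cases "root_seq n = 0") auto
  obtain k where k: "x = int k \<or> x = - int k"
    by (metis int_cases2)
  then have "root_sign (int k) \<noteq> 0"
    using nz by auto
  then have "k \<in> range root_seq"
    by (simp add: root_sign_nonzero_iff)
  moreover have "- int k \<notin> ?A"
    using pos \<open>x \<noteq> 0\<close> k by (auto simp: image_iff)
  ultimately show "(x \<in> ?A) \<noteq> (- x \<in> ?A)"
    using k by auto
qed auto

section \<open>Proof of the theorem\<close>

text \<open>The difference is 4pn(pn - r), and n(pn - r) is even because p and r are odd.\<close>

lemma dvd_square_diff:
  fixes u p r n :: int
  assumes "odd p" "odd r" "u = 2 * p * n - r \<or> - u = 2 * p * n - r"
  shows "8 * p dvd u\<^sup>2 - r\<^sup>2"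
proof -
  have "u\<^sup>2 = (2 * p * n - r)\<^sup>2"
    using assms(3) by (metis power2_minus)
  then have "u\<^sup>2 - r\<^sup>2 = 4 * p * (n * (p * n - r))"
    by (simp add: power2_eq_square algebra_simps)
  moreover have "even (n * (p * n - r))"
    using assms by simp
  then obtain k where "n * (p * n - r) = 2 * k"
    by blast
  ultimately have "u\<^sup>2 - r\<^sup>2 = 8 * p * k"
    by simp
  then show ?thesis
    by simp
qed

text \<open>Both divisions are exact, and c < m and d < n rule out negative quotients, so the
  exponents add; i and j bring them to the denominator 840.\<close>

lemma weight_mult:
  fixes u v c d m n i j :: int
  assumes "m dvd u\<^sup>2 - c" "n dvd v\<^sup>2 - d" "c < m" "d < n" "m > 0" "n > 0"
    and "i * m = 840" "j * n = 840" "i * c + j * d = 396"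
  shows "q ^ nat ((u\<^sup>2 - c) div m) * q ^ nat ((v\<^sup>2 - d) div n) = weight q (i * u\<^sup>2 + j * v\<^sup>2)"
proof -
  obtain k l where k: "u\<^sup>2 - c = m * k" and l: "v\<^sup>2 - d = n * l"
    using assms(1,2) by (elim dvdE)
  have nonneg: "b \<ge> 0" if "x\<^sup>2 - e = a * b" "e < a" "a > 0" for x e a b :: int
  proof (rule ccontr)
    assume "\<not> b \<ge> 0"
    then have "a * b \<le> a * (-1)"
      using that(3) by (intro mult_left_mono) auto
    then show False
      using that(1,2) zero_le_power2[of x] by linarith
  qed
  have "k \<ge> 0" "l \<ge> 0"
    using nonneg[OF k] nonneg[OF l] assms by auto
  have "i * u\<^sup>2 + j * v\<^sup>2 - 396 = i * (u\<^sup>2 - c) + j * (v\<^sup>2 - d)"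
    unfolding assms(9)[symmetric] by (simp add: algebra_simps)
  also have "\<dots> = (i * m) * k + (j * n) * l"
    unfolding k l by simp
  also have "\<dots> = 840 * (k + l)"
    unfolding assms(7,8) by simp
  finally have "weight q (i * u\<^sup>2 + j * v\<^sup>2) = q ^ nat (k + l)"
    by (simp add: weight_def)
  moreover have "(u\<^sup>2 - c) div m = k" "(v\<^sup>2 - d) div n = l"
    unfolding k l using assms by auto
  ultimately show ?thesis
    using \<open>k \<ge> 0\<close> \<open>l \<ge> 0\<close> by (simp add: nat_add_distrib power_add)
qed

lemma prod_term_has_sum:
  fixes q :: complex
  assumes "norm q < 1" "q \<noteq> 0"
  shows "(prod_term q has_sum
    2 * qpochs_inf [q, q ^ 6, q ^ 7] (q ^ 7) * (2 * qpochs_inf [q\<^sup>2, q ^ 3, q ^ 5] (q ^ 5))) UNIV"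
proof -
  have "((\<lambda>u. of_int (chi4 u * eps7 u) * q ^ nat ((u\<^sup>2 - 25) div 56)) has_sum
      2 * qpochs_inf [q, q ^ 6, q ^ 7] (q ^ 7)) UNIV"
    using theta_has_sum[OF assms, of 7 5 1 "\<lambda>u. chi4 u * eps7 u"] theta7_val theta7_supp by simp
  moreover have "((\<lambda>v. of_int (chi4 v * eps5 v) * q ^ nat ((v\<^sup>2 - 1) div 40)) has_sum
      2 * qpochs_inf [q\<^sup>2, q ^ 3, q ^ 5] (q ^ 5)) UNIV"
    using theta_has_sum[OF assms, of 5 1 2 "\<lambda>u. chi4 u * eps5 u"] theta5_val theta5_supp by simp
  ultimately have "((\<lambda>(u, v). (of_int (chi4 u * eps7 u) * q ^ nat ((u\<^sup>2 - 25) div 56)) *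
      (of_int (chi4 v * eps5 v) * q ^ nat ((v\<^sup>2 - 1) div 40))) has_sum
      2 * qpochs_inf [q, q ^ 6, q ^ 7] (q ^ 7) * (2 * qpochs_inf [q\<^sup>2, q ^ 3, q ^ 5] (q ^ 5))) UNIV"
    by (rule has_sum_times)
  moreover have "(of_int (chi4 u * eps7 u) * q ^ nat ((u\<^sup>2 - 25) div 56)) *
      (of_int (chi4 v * eps5 v) * q ^ nat ((v\<^sup>2 - 1) div 40)) = prod_term q (u, v)" for u v
  proof (cases "chi4 u * eps7 u = 0 \<or> chi4 v * eps5 v = 0")
    case False
    then have "56 dvd u\<^sup>2 - 25" "40 dvd v\<^sup>2 - 1"
      using theta7_supp[of u] theta5_supp[of v] dvd_square_diff[of 7 5 u] dvd_square_diff[of 5 1 v]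
      by auto
    then have "q ^ nat ((u\<^sup>2 - 25) div 56) * q ^ nat ((v\<^sup>2 - 1) div 40) = weight q (15 * u\<^sup>2 + 21 * v\<^sup>2)"
      by (intro weight_mult) auto
    then show ?thesis
      unfolding prod_term_def prod.case by (simp only: of_int_mult mult_ac)
  qed (auto simp: prod_term_def)
  ultimately show ?thesis
    by (simp add: case_prod_unfold)
qed

lemma sum_term_has_sum_euler:
  fixes q :: complex
  assumes "norm q < 1" "q \<noteq> 0"
    and "((\<lambda>n. (-1) ^ t n * q ^ a_seq n) has_sum S) UNIV"
  shows "(sum_term q has_sum 2 * S * (2 * qpoch_inf q q)) UNIV"
proof -
  \<comment> \<open>For p = 3 the three factors cover all residues, so the theta product is
    (q;q)_inf and its series is Euler's pentagonal number series.\<close>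
  have "(\<Prod>r<3. qpoch_inf (q ^ Suc r) (q ^ 3)) = qpochs_inf [q, q\<^sup>2, q ^ 3] (q ^ 3)"
    by (simp add: qpochs_inf_def eval_nat_numeral mult.assoc)
  then have euler: "qpochs_inf [q, q\<^sup>2, q ^ 3] (q ^ 3) = qpoch_inf q q"
    using prod_qpoch_inf_residues[OF assms(1), of 3] by simp
  have "((\<lambda>y. of_int (chi3 y * chi4 y) * q ^ nat ((y\<^sup>2 - 1) div 24)) has_sum 2 * qpoch_inf q q) UNIV"
    using theta_has_sum[OF assms(1,2), of 3 1 1 "\<lambda>u. chi3 u * chi4 u"] theta3_val theta3_supp euler
    by (simp add: numeral_2_eq_2[symmetric])
  with root_has_sum[OF assms(3)]
  have "((\<lambda>(x, y). (of_int (root_sign x) * q ^ nat ((x\<^sup>2 - 361) div 840)) *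
      (of_int (chi3 y * chi4 y) * q ^ nat ((y\<^sup>2 - 1) div 24))) has_sum 2 * S * (2 * qpoch_inf q q)) UNIV"
    by (rule has_sum_times)
  moreover have "(of_int (root_sign x) * q ^ nat ((x\<^sup>2 - 361) div 840)) *
      (of_int (chi3 y * chi4 y) * q ^ nat ((y\<^sup>2 - 1) div 24)) = sum_term q (x, y)" for x y
  proof (cases "root_sign x = 0 \<or> chi3 y * chi4 y = 0")
    case False
    have "24 dvd y\<^sup>2 - 1"
      using False theta3_supp[of y] dvd_square_diff[of 3 1 y] by auto
    moreover have "840 dvd x\<^sup>2 - 361"
    proof -
      obtain k where k: "x = int k \<or> x = - int k"
        by (metis int_cases2)
      then have "root_sign (int k) \<noteq> 0"
        using False by auto
      then have "k\<^sup>2 mod 840 = 361"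
        using root_sign_nonzero_iff mem_range_root_seq_iff by blast
      then have "x\<^sup>2 mod 840 = 361 mod 840"
        using k by (auto simp flip: of_nat_power zmod_int) (metis of_nat_mod of_nat_numeral)+
      then show ?thesis
        by (simp only: mod_eq_dvd_iff)
    qed
    ultimately have "q ^ nat ((x\<^sup>2 - 361) div 840) * q ^ nat ((y\<^sup>2 - 1) div 24)
        = weight q (1 * x\<^sup>2 + 35 * y\<^sup>2)"
      by (intro weight_mult) auto
    then show ?thesis
      unfolding sum_term_def prod.case root_sign_def by (simp only: of_int_mult mult_ac mult_1)
  qed (auto simp: sum_term_def root_sign_def)
  ultimately show ?thesis
    by (simp add: case_prod_unfold)
qed

lemma qpoch_inf_0_0: "qpoch_inf 0 0 = 1"
  by (simp add: qpoch_inf_def)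

theorem theorem1:
  fixes q :: complex
  assumes "norm q < 1"
  shows "(\<lambda>n. (-1) ^ t n * q ^ a_seq n) sums
           (qpochs_inf [q, q ^ 6, q ^ 7] (q ^ 7) / qpochs_inf [q, q ^ 4] (q ^ 5))"
proof (cases "q = 0")
  \<comment> \<open>The triple product is applied at z = q^k, which must be nonzero, so q = 0 is
    treated apart. Only the exponent 0 survives here, coming from 19^2 = 361.\<close>
  case True
  have "root_seq 0 = 19"
    by (simp add: root_seq_def root_residues_def)
  then have "a_seq 0 = 0"
    using square_root_seq[of 0] by simp
  moreover have "a_seq n > 0" if "n > 0" for n
    using strict_mono_imp_increasing[OF strict_mono_a_seq, of n] that by linarith
  ultimately have "(\<lambda>n. (-1) ^ t n * q ^ a_seq n) = (\<lambda>n. if n = 0 then 1 else 0)"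
    by (auto simp: fun_eq_iff True t_def)
  then show ?thesis
    using sums_single[of 0 "\<lambda>_. 1 :: complex"] by (simp add: True qpochs_inf_def qpoch_inf_0_0)
next
  case False
  define S where "S = infsum (\<lambda>n. (-1) ^ t n * q ^ a_seq n) UNIV"
  have S: "((\<lambda>n. (-1) ^ t n * q ^ a_seq n) has_sum S) UNIV"
    unfolding S_def using a_seq_summable[OF assms] by simp
  \<comment> \<open>Splitting (q;q)_inf modulo 5 isolates the denominator; the complementary factor
    is the theta product that multiplies the numerator, and it cancels in the end.\<close>
  have "(\<Prod>r<5. qpoch_inf (q ^ Suc r) (q ^ 5))
      = qpochs_inf [q, q ^ 4] (q ^ 5) * qpochs_inf [q\<^sup>2, q ^ 3, q ^ 5] (q ^ 5)"
    by (simp add: qpochs_inf_def eval_nat_numeral mult_ac)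
  then have euler: "qpochs_inf [q, q ^ 4] (q ^ 5) * qpochs_inf [q\<^sup>2, q ^ 3, q ^ 5] (q ^ 5) = qpoch_inf q q"
    using prod_qpoch_inf_residues[OF assms, of 5] by simp
  have "qpoch_inf q q \<noteq> 0"
    by (rule qpoch_inf_nonzero[OF assms assms])
  then have nz: "qpochs_inf [q, q ^ 4] (q ^ 5) \<noteq> 0" "qpochs_inf [q\<^sup>2, q ^ 3, q ^ 5] (q ^ 5) \<noteq> 0"
    unfolding euler[symmetric] by simp_all
  have "2 * qpochs_inf [q, q ^ 6, q ^ 7] (q ^ 7) * (2 * qpochs_inf [q\<^sup>2, q ^ 3, q ^ 5] (q ^ 5))
      = 2 * S * (2 * qpoch_inf q q)"
    by (rule prod_sum_eq_sum_sum[OF prod_term_has_sum[OF assms False]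
          sum_term_has_sum_euler[OF assms False S]])
  then have "qpochs_inf [q, q ^ 6, q ^ 7] (q ^ 7) = S * qpochs_inf [q, q ^ 4] (q ^ 5)"
    using nz unfolding euler[symmetric] by simp
  then have "S = qpochs_inf [q, q ^ 6, q ^ 7] (q ^ 7) / qpochs_inf [q, q ^ 4] (q ^ 5)"
    using nz by (simp add: field_simps)
  then show ?thesis
    using has_sum_imp_sums[OF S] by simp
qed

end
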